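(* Let $\mathbb{M}$ be a partial group acting on an abelian group $G$ via a homomorphism of partial groups $\varphi\colon \mathbb{M}\to \operatorname{Aut}(G)$. Let $A\colon \Pi_1\mathbb{M}\to \mathbf{Ab}$ be the local coefficient system induced by $\varphi$ and $G$, i.e. the covariant functor with $A( * )=G$ on the unique object $*$ and $A(x)=\varphi(x)^{-1}$ for every $x\in\mathbb{M}_1$. Then the generalized group cohomology of $\mathbb{M}$ and the cohomology of $\mathbb{M}$ with local coefficients in $A$ coincide; that is, for every $n\ge 0$, $$H^n_\varphi(\mathbb{M},G)\cong H^n(\mathbb{M};A).$$
   Context: **Partial groups.** A partial monoid is a nonempty simplicial set $\mathbb{M}$ that is reduced ($\mathbb{M}_0=\{*\}$) and such that for every $n\ge 1$ the spine operator $\boldsymbol{e}^n=(e_1^n,\dots,e_n^n)\colon \mathbb{M}_n\to(\mathbb{M}_1)^n$ is injective, where $e_i^n\colon \mathbb{M}_n\to\mathbb{M}_1$ is induced by the nondecreasing map $[1]\to[n]$ with image $\{i-1,i\}$. A simplex $x\in\mathbb{M}_n$ with spine $(x_1,\dots,x_n)$ is written $x=[x_1|\dots|x_n]$. The product $\Pi\colon\mathbb{M}_n\to\mathbb{M}_1$ is induced by the map $[1]\to[n]$ with image $\{0,n\}$; write $x_1\cdots x_n=\Pi[x_1|\dots|x_n]$ and $1=s_0( * )$. Thus $d_0[x_1|\dots|x_n]=[x_2|\dots|x_n]$, $d_n[x_1|\dots|x_n]=[x_1|\dots|x_{n-1}]$, $d_i[x_1|\dots|x_n]=[x_1|\dots|x_i\cdot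 x_{i+1}|\dots|x_n]$ for $1\le i\le n-1$, and degeneracies insert a $1$. The opposite simplicial set $X^{\mathrm{op}}$ has $X^{\mathrm{op}}_n=X_n$ with faces $d_{n-i}$ and degeneracies $s_{n-i}$ in place of $d_i$, $s_i$. A partial group is a partial monoid together with an inversion: a simplicial map $\nu\colon\mathbb{M}\to\mathbb{M}^{\mathrm{op}}$ with inverse $\nu^{\mathrm{op}}$ such that for all $u\in\mathbb{M}_n$, $n\ge1$, the concatenation $[\nu(u)|u]$ is a simplex in $\mathbb{M}_{2n}$ and $\Pi[\nu(u)|u]=1$. Homomorphisms of partial groups are simplicial maps. A group $H$ is viewed as a partial group with set of $n$-simplices $H^n$ (its bar construction); in particular $\operatorname{Aut}(G)$ is a partial group, and an action of $\mathbb{M}$ on $G$ is a homomorphism of partial groups $\varphi\colon\mathbb{M}\to\operatorname{Aut}(G)$; for $x\in\mathbb{M}_1$, $\varphi(x)\in\operatorname{Aut}(G)$ and $\varphi(x_1\cdot x_2)=\varphi(x_1)\circ\varphi(x_2)$ for $[x_1|x_2]\in\mathbb{M}_2$. **Generalized group cohomology.** $C^n_\varphi(\mathbb{M},G)$ is the abelian group of all functions $\mathbb{M}_n\to G$, and $\delta^{n-1}_\varphi\colon C^{n-1}_\varphi(\mathbb{M},G)\to C^n_\varphi(\mathbb{M},G)$ is $$\delta^{n-1}_\varphi(\psi)([x_1|\dots|x_n])=\varphi(x_1)\big(\psi(d_0[x_1|\dots|x_n])\big)+\sum_{i=1}^n(-1)^i\psi(d_i[x_1|\dots|x_n]).$$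 This is a cochain complex, and $H^n_\varphi(\mathbb{M},G)$ is its $n$-th cohomology group. **Cohomology with local coefficients.** For a simplicial set $X$, $\Pi_1X$ is the fundamental groupoid: the free groupoid on the path category of $X$, whose objects are the vertices of $X$ and whose morphisms are freely generated by the $1$-simplices $u\colon d_1u\to d_0u$ subject to $d_1\sigma=d_0\sigma\circ d_2\sigma$ for every $2$-simplex $\sigma$ (degenerate edges being identities). $\Pi_1$ is left adjoint to the nerve functor $\operatorname{Ner}$ from groupoids to simplicial sets; let $\eta_X\colon X\to\operatorname{Ner}(\Pi_1X)$ be the unit. A system of local coefficients is a covariant functor $A\colon\Pi_1X\to\mathbf{Ab}$. For $x\in X_n$ with $\eta_X(x)=(x_0\xrightarrow{u_1}x_1\to\cdots\to x_n)$, an $n$-cochain $\psi$ assigns to each $x\in X_n$ an element $\psi(x)\in A(x_0)$; it is normalized if $\psi(x)=0$ for all degenerate $x$. Normalized $n$-cochains form an abelian group $C^n_{\eta_X}(X,A)$ under pointwise addition, with coboundary, for $x\in X_n$, $$(\delta^{n-1}\psi)(x)=A(u_1)^{-1}\big(\psi(d_0x)\big)+\sum_{i=1}^n(-1)^i\psi(d_ix).$$ This is a cochain complex, and $H^n(X;A)$ is its $n$-th cohomology group. For $X=\mathbb{M}$ a partial group, $\eta_{\mathbb{M}}([x_1|\dots|x_n])=( *\xrightarrow{x_1}*\xrightarrow{x_2}\cdots\xrightarrow{x_n}* )$, and a local coefficient system amounts to an abelian group $G$ with automorphisms $A(x)$, $x\in\mathbb{M}_1$, satisfying $A(x_1\cdot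 x_2)=A(x_2)\circ A(x_1)$ for all $[x_1|x_2]\in\mathbb{M}_2$. *)

theory Defs
  imports "HOL-Algebra.FiniteProduct" "HOL-Algebra.Product_Groups" "HOL-Algebra.Bij"
begin

section \<open>Simplicial sets\<close>

text \<open>The set of nondecreasing maps from [m] to [n], made extensional so that each map of
  ordinals has exactly one representative.\<close>

definition ord_maps :: "nat \<Rightarrow> nat \<Rightarrow> (nat \<Rightarrow> nat) set" where
  "ord_maps m n = {\<theta> \<in> {..m} \<rightarrow>\<^sub>E {..n}. mono_on {..m} \<theta>}"

text \<open>A simplicial set is a contravariant functor on the ordinals [n]:
  \<open>oper X m n \<theta>\<close> is the operator from n-simplices to m-simplices induced by \<open>\<theta> \<in> ord_maps m n\<close>.
  All simplices live in one type; the sets of simplices of different dimensions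
  need not be disjoint.\<close>

record 'a sset =
  simps :: "nat \<Rightarrow> 'a set"
  oper :: "nat \<Rightarrow> nat \<Rightarrow> (nat \<Rightarrow> nat) \<Rightarrow> 'a \<Rightarrow> 'a"

locale simplicial_set =
  fixes X :: "'a sset"
  assumes oper_closed:
      "\<lbrakk>\<theta> \<in> ord_maps m n; x \<in> simps X n\<rbrakk> \<Longrightarrow> oper X m n \<theta> x \<in> simps X m"
    and oper_id:
      "x \<in> simps X n \<Longrightarrow> oper X n n (restrict id {..n}) x = x"
    and oper_comp:
      "\<lbrakk>\<rho> \<in> ord_maps k m; \<theta> \<in> ord_maps m n; x \<in> simps X n\<rbrakk>
        \<Longrightarrow> oper X k n (compose {..k} \<theta> \<rho>) x = oper X k m \<rho> (oper X m n \<theta> x)"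

definition simplicial_map :: "'a sset \<Rightarrow> 'b sset \<Rightarrow> (nat \<Rightarrow> 'a \<Rightarrow> 'b) \<Rightarrow> bool" where
  "simplicial_map X Y f \<longleftrightarrow>
     (\<forall>n. \<forall>x\<in>simps X n. f n x \<in> simps Y n) \<and>
     (\<forall>m n. \<forall>\<theta>\<in>ord_maps m n. \<forall>x\<in>simps X n.
        f m (oper X m n \<theta> x) = oper Y m n \<theta> (f n x))"

text \<open>In \<open>face X n i\<close> and \<open>degen X n i\<close> the number n is the dimension of the argument.\<close>

definition face :: "'a sset \<Rightarrow> nat \<Rightarrow> nat \<Rightarrow> 'a \<Rightarrow> 'a" where
  "face X n i = oper X (n - 1) n (\<lambda>j\<in>{..n - 1}. if j < i then j else Suc j)"

definition degen :: "'a sset \<Rightarrow> nat \<Rightarrow> nat \<Rightarrow> 'a \<Rightarrow> 'a" where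
  "degen X n i = oper X (Suc n) n (\<lambda>j\<in>{..Suc n}. if j \<le> i then j else j - 1)"

definition degenerate :: "'a sset \<Rightarrow> nat \<Rightarrow> 'a \<Rightarrow> bool" where
  "degenerate X n x \<longleftrightarrow> (\<exists>m i y. n = Suc m \<and> i \<le> m \<and> y \<in> simps X m \<and> x = degen X m i y)"

definition vert :: "'a sset \<Rightarrow> nat \<Rightarrow> nat \<Rightarrow> 'a \<Rightarrow> 'a" where
  "vert X n i = oper X 0 n (\<lambda>j\<in>{..0}. i)"

definition edge :: "'a sset \<Rightarrow> nat \<Rightarrow> nat \<Rightarrow> 'a \<Rightarrow> 'a" where
  "edge X n i = oper X 1 n (\<lambda>j\<in>{..1}. if j = 0 then i - 1 else i)"

definition spine :: "'a sset \<Rightarrow> nat \<Rightarrow> 'a \<Rightarrow> 'a list" where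
  "spine X n x = map (\<lambda>i. edge X n i x) [1..<Suc n]"

definition total_edge :: "'a sset \<Rightarrow> nat \<Rightarrow> 'a \<Rightarrow> 'a" where
  "total_edge X n = oper X 1 n (\<lambda>j\<in>{..1}. if j = 0 then 0 else n)"

text \<open>Conjugating an operator with the order reversals of [m] and [n] turns the coface and
  codegeneracy with index i into those with index n - i.\<close>

definition rev_map :: "nat \<Rightarrow> nat \<Rightarrow> (nat \<Rightarrow> nat) \<Rightarrow> nat \<Rightarrow> nat" where
  "rev_map m n \<theta> = (\<lambda>j\<in>{..m}. n - \<theta> (m - j))"

definition opposite :: "'a sset \<Rightarrow> 'a sset" where
  "opposite X = \<lparr>simps = simps X, oper = (\<lambda>m n \<theta>. oper X m n (rev_map m n \<theta>))\<rparr>"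


section \<open>Partial groups\<close>

locale partial_monoid = simplicial_set M for M :: "'a sset" +
  assumes reduced: "\<exists>p. simps M 0 = {p}"
    and spine_inj: "n \<ge> 1 \<Longrightarrow> inj_on (spine M n) (simps M n)"

text \<open>Since the underlying functions of a simplicial map and its opposite are the same, that
  the inverse of \<open>\<nu>\<close> is its opposite means that \<open>\<nu>\<close> is involutive in each dimension.\<close>

locale partial_group = partial_monoid M for M :: "'a sset" +
  fixes \<nu> :: "nat \<Rightarrow> 'a \<Rightarrow> 'a"
  assumes inversion_map: "simplicial_map M (opposite M) \<nu>"
    and inversion_inverse: "x \<in> simps M n \<Longrightarrow> \<nu> n (\<nu> n x) = x"
    and inversion_concat: "\<lbrakk>n \<ge> 1; u \<in> simps M n; p \<in> simps M 0\<rbrakk> \<Longrightarrow>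
      \<exists>w\<in>simps M (2 * n). spine M (2 * n) w = spine M n (\<nu> n u) @ spine M n u \<and>
        total_edge M (2 * n) w = degen M 0 0 p"

text \<open>The bar construction of a group, with \<open>[x_1, \<dots>, x_n]\<close> as the simplex
  \<open>[x_1|\<dots>|x_n]\<close>; list positions are counted from 0.  The i-th entry of the image
  under \<open>\<theta>\<close> is the product of all \<open>x_k\<close> with \<open>\<theta> (i - 1) < k \<le> \<theta> i\<close>.\<close>

definition seg_prod :: "('h, 'b) monoid_scheme \<Rightarrow> 'h list \<Rightarrow> nat \<Rightarrow> nat \<Rightarrow> 'h" where
  "seg_prod H xs a b = foldr (\<lambda>k y. xs ! k \<otimes>\<^bsub>H\<^esub> y) [a..<b] \<one>\<^bsub>H\<^esub>"

definition bar :: "('h, 'b) monoid_scheme \<Rightarrow> 'h list sset" where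
  "bar H = \<lparr>simps = (\<lambda>n. {xs. length xs = n \<and> set xs \<subseteq> carrier H}),
            oper = (\<lambda>m n \<theta> xs. map (\<lambda>i. seg_prod H xs (\<theta> i) (\<theta> (Suc i))) [0..<m])\<rparr>"

context group begin

lemma fold_closed:
  "(\<And>k. k \<in> set ks \<Longrightarrow> f k \<in> carrier G) \<Longrightarrow> foldr (\<lambda>k y. f k \<otimes> y) ks \<one> \<in> carrier G"
  by (induction ks) auto

lemma fold_append:
  "(\<And>k. k \<in> set (ks @ ls) \<Longrightarrow> f k \<in> carrier G) \<Longrightarrow> foldr (\<lambda>k y. f k \<otimes> y) (ks @ ls) \<one>
    = foldr (\<lambda>k y. f k \<otimes> y) ks \<one> \<otimes> foldr (\<lambda>k y. f k \<otimes> y) ls \<one>"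
proof (induction ks)
  case Nil
  then show ?case by (simp add: fold_closed)
next
  case (Cons a ks)
  then show ?case by (simp add: fold_closed m_assoc del: foldr_append)
qed

lemma nth_carrier: "set xs \<subseteq> carrier G \<Longrightarrow> k < length xs \<Longrightarrow> xs ! k \<in> carrier G"
  using nth_mem by blast

lemma seg_closed:
  "set xs \<subseteq> carrier G \<Longrightarrow> b \<le> length xs \<Longrightarrow> seg_prod G xs a b \<in> carrier G"
  unfolding seg_prod_def by (rule fold_closed) (auto simp: nth_carrier)

lemma seg_append:
  assumes "set xs \<subseteq> carrier G" "a \<le> b" "b \<le> c" "c \<le> length xs"
  shows "seg_prod G xs a b \<otimes> seg_prod G xs b c = seg_prod G xs a c"
proof -
  have "[a..<c] = [a..<b] @ [b..<c]"
    using assms upt_add_eq_append[of a b "c - b"] by simp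
  then show ?thesis
    unfolding seg_prod_def using assms
    by (simp only:, subst fold_append) (auto intro: nth_carrier)
qed

lemma seg_empty [simp]: "seg_prod G xs a a = \<one>"
  by (simp add: seg_prod_def)

lemma seg_single:
  "set xs \<subseteq> carrier G \<Longrightarrow> a < length xs \<Longrightarrow> seg_prod G xs a (Suc a) = xs ! a"
  by (simp add: seg_prod_def nth_carrier)

lemma seg_map:
  assumes "set xs \<subseteq> carrier G" "\<theta> \<in> ord_maps m n" "length xs = n" "a \<le> b" "b \<le> m"
  shows "seg_prod G (map (\<lambda>i. seg_prod G xs (\<theta> i) (\<theta> (Suc i))) [0..<m]) a b
    = seg_prod G xs (\<theta> a) (\<theta> b)"
  using \<open>a \<le> b\<close> \<open>b \<le> m\<close>
proof (induction b rule: dec_induct)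
  case base
  then show ?case by simp
next
  case (step b)
  let ?ys = "map (\<lambda>i. seg_prod G xs (\<theta> i) (\<theta> (Suc i))) [0..<m]"
  have th: "\<theta> i \<le> n" if "i \<le> m" for i
    using assms(2) that by (auto simp: ord_maps_def PiE_iff)
  have mo: "\<theta> i \<le> \<theta> j" if "i \<le> j" "j \<le> m" for i j
    using assms(2) that by (auto simp: ord_maps_def mono_on_def)
  have ys: "set ?ys \<subseteq> carrier G"
    using assms th by (auto intro!: seg_closed)
  have "seg_prod G ?ys a (Suc b) = seg_prod G ?ys a b \<otimes> seg_prod G ?ys b (Suc b)"
    using ys step by (intro seg_append[symmetric]) auto
  also have "\<dots> = seg_prod G xs (\<theta> a) (\<theta> b) \<otimes> seg_prod G xs (\<theta> b) (\<theta> (Suc b))"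
    using step ys by (subst seg_single) auto
  also have "\<dots> = seg_prod G xs (\<theta> a) (\<theta> (Suc b))"
    using step assms th mo by (intro seg_append) auto
  finally show ?case .
qed

lemma bar_simplicial_set: "simplicial_set (bar G)"
proof
  fix \<theta> m n and xs :: "'a list"
  assume "\<theta> \<in> ord_maps m n" "xs \<in> simps (bar G) n"
  then show "oper (bar G) m n \<theta> xs \<in> simps (bar G) m"
    by (auto simp: bar_def ord_maps_def PiE_iff intro!: seg_closed)
next
  fix n and xs :: "'a list"
  assume "xs \<in> simps (bar G) n"
  then show "oper (bar G) n n (restrict id {..n}) xs = xs"
    by (auto simp: bar_def seg_single intro!: nth_equalityI)
next
  fix \<rho> k m \<theta> n and xs :: "'a list"
  assume *: "\<rho> \<in> ord_maps k m" "\<theta> \<in> ord_maps m n" "xs \<in> simps (bar G) n"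
  have "\<rho> i \<le> \<rho> (Suc i) \<and> \<rho> (Suc i) \<le> m" if "i < k" for i
    using *(1) that by (auto simp: ord_maps_def PiE_iff mono_on_def)
  with * show "oper (bar G) k n (compose {..k} \<theta> \<rho>) xs
      = oper (bar G) k m \<rho> (oper (bar G) m n \<theta> xs)"
    by (auto simp: bar_def compose_def seg_map)
qed

lemma spine_bar:
  assumes "xs \<in> simps (bar G) n"
  shows "spine (bar G) n xs = map (\<lambda>x. [x]) xs"
proof -
  have l: "length xs = n" "set xs \<subseteq> carrier G" using assms by (auto simp: bar_def)
  have e: "edge (bar G) n (Suc i) xs = [xs ! i]" if "i < n" for i
    using l that by (simp add: edge_def bar_def seg_single)
  show ?thesis
    unfolding spine_def using l e
    by (intro nth_equalityI) (auto simp del: upt_Suc)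
qed

lemma seg_rev_inv:
  assumes "set xs \<subseteq> carrier G" "length xs = n" "a \<le> b" "b \<le> n"
  shows "seg_prod G (rev (map (\<lambda>x. inv x) xs)) a b = inv (seg_prod G xs (n - b) (n - a))"
  using \<open>a \<le> b\<close> \<open>b \<le> n\<close>
proof (induction b rule: dec_induct)
  case base
  then show ?case by simp
next
  case (step b)
  let ?ys = "rev (map (\<lambda>x. inv x) xs)"
  have ys: "set ?ys \<subseteq> carrier G" using assms by auto
  have nth: "?ys ! b = inv (xs ! (n - Suc b))"
    using step assms by (simp add: rev_nth)
  have "seg_prod G ?ys a (Suc b) = seg_prod G ?ys a b \<otimes> seg_prod G ?ys b (Suc b)"
    using ys step assms by (intro seg_append[symmetric]) auto
  also have "\<dots> = inv (seg_prod G xs (n - b) (n - a)) \<otimes> inv (seg_prod G xs (n - Suc b) (n - b))"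
    using step ys assms nth seg_single[of xs "n - Suc b"] by (subst seg_single) (auto simp: Suc_diff_Suc)
  also have "\<dots> = inv (seg_prod G xs (n - Suc b) (n - b) \<otimes> seg_prod G xs (n - b) (n - a))"
    using assms by (intro inv_mult_group[symmetric] seg_closed) auto
  also have "\<dots> = inv (seg_prod G xs (n - Suc b) (n - a))"
    using step assms by (subst seg_append) auto
  finally show ?case .
qed

lemma bar_partial_group: "partial_group (bar G) (\<lambda>n xs. rev (map (\<lambda>x. inv x) xs))"
proof -
  interpret simplicial_set "bar G" by (rule bar_simplicial_set)
  show ?thesis
  proof
    show "\<exists>p. simps (bar G) 0 = {p}" by (auto simp: bar_def)
    show "inj_on (spine (bar G) n) (simps (bar G) n)" if "n \<ge> 1" for n
    proof (rule inj_onI)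
      fix xs ys
      assume *: "xs \<in> simps (bar G) n" "ys \<in> simps (bar G) n"
        "spine (bar G) n xs = spine (bar G) n ys"
      then have "map hd (map (\<lambda>x. [x]) xs) = map hd (map (\<lambda>x. [x]) ys)"
        by (simp add: spine_bar)
      then show "xs = ys" by (simp add: o_def)
    qed
    show "simplicial_map (bar G) (opposite (bar G)) (\<lambda>n xs. rev (map (\<lambda>x. inv x) xs))"
      unfolding simplicial_map_def
    proof (intro conjI allI ballI)
      fix n and xs :: "'a list" assume "xs \<in> simps (bar G) n"
      then show "rev (map (\<lambda>x. inv x) xs) \<in> simps (opposite (bar G)) n"
        by (auto simp: bar_def opposite_def)
    next
      fix m n \<theta> and xs :: "'a list"
      assume *: "\<theta> \<in> ord_maps m n" "xs \<in> simps (bar G) n"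
      have th: "\<theta> i \<le> n" if "i \<le> m" for i
        using * that by (auto simp: ord_maps_def PiE_iff)
      have mo: "\<theta> i \<le> \<theta> j" if "i \<le> j" "j \<le> m" for i j
        using * that by (auto simp: ord_maps_def mono_on_def)
      have "seg_prod G (rev (map (\<lambda>x. inv x) xs)) (n - \<theta> (m - i)) (n - \<theta> (m - Suc i))
          = inv (seg_prod G xs (\<theta> (m - Suc i)) (\<theta> (m - i)))" if "i < m" for i
        using * that th mo[of "m - Suc i" "m - i"]
        by (subst seg_rev_inv[where n = n]) (auto simp: bar_def intro: diff_le_mono2)
      then show "rev (map (\<lambda>x. inv x) (oper (bar G) m n \<theta> xs))
          = oper (opposite (bar G)) m n \<theta> (rev (map (\<lambda>x. inv x) xs))"
        by (intro nth_equalityI) (auto simp: bar_def opposite_def rev_map_def rev_nth Suc_diff_Suc)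
    qed
    show "rev (map (\<lambda>x. inv x) (rev (map (\<lambda>x. inv x) xs))) = xs"
      if "xs \<in> simps (bar G) n" for xs n
      using that by (auto simp: bar_def rev_map o_def intro!: map_idI)
    show "\<exists>w\<in>simps (bar G) (2 * n).
        spine (bar G) (2 * n) w = spine (bar G) n (rev (map (\<lambda>x. inv x) xs)) @ spine (bar G) n xs \<and>
        total_edge (bar G) (2 * n) w = degen (bar G) 0 0 p"
      if "n \<ge> 1" "xs \<in> simps (bar G) n" "p \<in> simps (bar G) 0" for n xs p
    proof -
      let ?ys = "rev (map (\<lambda>x. inv x) xs)"
      have xs: "length xs = n" "set xs \<subseteq> carrier G" using that by (auto simp: bar_def)
      then have w: "?ys @ xs \<in> simps (bar G) (2 * n)" and ys: "?ys \<in> simps (bar G) n"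
        by (auto simp: bar_def)
      have a: "seg_prod G (?ys @ xs) 0 n = seg_prod G ?ys 0 n"
        unfolding seg_prod_def using xs by (intro foldr_cong) (auto simp: nth_append)
      have b: "seg_prod G (?ys @ xs) n (2 * n) = seg_prod G xs 0 n"
      proof -
        have "[n..<2 * n] = map (\<lambda>i. i + n) [0..<n]" by (simp add: map_add_upt mult_2)
        then show ?thesis
          unfolding seg_prod_def using xs by (simp add: foldr_map o_def nth_append)
      qed
      have "seg_prod G (?ys @ xs) 0 (2 * n) = seg_prod G (?ys @ xs) 0 n \<otimes> seg_prod G (?ys @ xs) n (2 * n)"
        using xs by (intro seg_append[symmetric]) auto
      also have "\<dots> = inv (seg_prod G xs 0 n) \<otimes> seg_prod G xs 0 n"
        unfolding a b using xs by (subst seg_rev_inv) auto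
      also have "\<dots> = \<one>" using xs by (simp add: seg_closed)
      finally have "seg_prod G (?ys @ xs) 0 (2 * n) = \<one>" .
      then have "total_edge (bar G) (2 * n) (?ys @ xs) = degen (bar G) 0 0 p"
        by (simp add: total_edge_def degen_def bar_def)
      moreover have "spine (bar G) (2 * n) (?ys @ xs) = spine (bar G) n ?ys @ spine (bar G) n xs"
        using that w ys by (simp add: spine_bar)
      ultimately show ?thesis using w by blast
    qed
  qed
qed

end

definition partial_action ::
    "'a sset \<Rightarrow> 'g monoid \<Rightarrow> (nat \<Rightarrow> 'a \<Rightarrow> ('g \<Rightarrow> 'g) list) \<Rightarrow> bool" where
  "partial_action M G \<phi> \<longleftrightarrow> simplicial_map M (bar (AutoGroup G)) \<phi>"

text \<open>The automorphism by which a 1-simplex acts; \<open>\<phi> 1 x\<close> itself is a list of length 1.\<close>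

definition act :: "(nat \<Rightarrow> 'a \<Rightarrow> ('g \<Rightarrow> 'g) list) \<Rightarrow> 'a \<Rightarrow> 'g \<Rightarrow> 'g" where
  "act \<phi> x = hd (\<phi> 1 x)"


section \<open>Cohomology of partial groups\<close>

text \<open>The incoming differential in degree 0 is the zero map.\<close>

definition cohomology :: "(nat \<Rightarrow> 'c monoid) \<Rightarrow> (nat \<Rightarrow> 'c \<Rightarrow> 'c) \<Rightarrow> nat \<Rightarrow> 'c set monoid" where
  "cohomology C \<delta> n =
     (C n)\<lparr>carrier := kernel (C n) (C (Suc n)) (\<delta> n)\<rparr> Mod
     (if n = 0 then {\<one>\<^bsub>C n\<^esub>} else \<delta> (n - 1) ` carrier (C (n - 1)))"

definition action_cochains :: "'a sset \<Rightarrow> 'g monoid \<Rightarrow> nat \<Rightarrow> ('a \<Rightarrow> 'g) monoid" where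
  "action_cochains M G n = product_group (simps M n) (\<lambda>_. G)"

text \<open>The abelian coefficient groups are written multiplicatively.  The coboundary with
  index n maps n-cochains to (n+1)-cochains.\<close>

definition action_coboundary ::
    "'a sset \<Rightarrow> 'g monoid \<Rightarrow> (nat \<Rightarrow> 'a \<Rightarrow> ('g \<Rightarrow> 'g) list) \<Rightarrow> nat \<Rightarrow> ('a \<Rightarrow> 'g) \<Rightarrow> 'a \<Rightarrow> 'g" where
  "action_coboundary M G \<phi> n \<psi> =
     (\<lambda>x\<in>simps M (Suc n).
        act \<phi> (edge M (Suc n) 1 x) (\<psi> (face M (Suc n) 0 x)) \<otimes>\<^bsub>G\<^esub>
        (\<Otimes>\<^bsub>G\<^esub>i\<in>{1..Suc n}. \<psi> (face M (Suc n) i x) [^]\<^bsub>G\<^esub> ((-1) ^ i :: int)))"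

definition action_cohomology ::
    "'a sset \<Rightarrow> 'g monoid \<Rightarrow> (nat \<Rightarrow> 'a \<Rightarrow> ('g \<Rightarrow> 'g) list) \<Rightarrow> nat \<Rightarrow> ('a \<Rightarrow> 'g) set monoid" where
  "action_cohomology M G \<phi> n = cohomology (action_cochains M G) (action_coboundary M G \<phi>) n"


section \<open>The fundamental groupoid\<close>

record ('o, 'm) cat =
  obs :: "'o set"
  mors :: "'m set"
  dom_of :: "'m \<Rightarrow> 'o"
  cod_of :: "'m \<Rightarrow> 'o"
  ident :: "'o \<Rightarrow> 'm"
  cmp :: "'m \<Rightarrow> 'm \<Rightarrow> 'm"

locale is_groupoid =
  fixes C :: "('o, 'm) cat"
  assumes dom_in: "f \<in> mors C \<Longrightarrow> dom_of C f \<in> obs C"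
    and cod_in: "f \<in> mors C \<Longrightarrow> cod_of C f \<in> obs C"
    and ident_in: "x \<in> obs C \<Longrightarrow> ident C x \<in> mors C \<and>
      dom_of C (ident C x) = x \<and> cod_of C (ident C x) = x"
    and comp_in: "\<lbrakk>f \<in> mors C; g \<in> mors C; cod_of C f = dom_of C g\<rbrakk> \<Longrightarrow> cmp C g f \<in> mors C \<and>
      dom_of C (cmp C g f) = dom_of C f \<and> cod_of C (cmp C g f) = cod_of C g"
    and comp_assoc: "\<lbrakk>f \<in> mors C; g \<in> mors C; h \<in> mors C;
      cod_of C f = dom_of C g; cod_of C g = dom_of C h\<rbrakk>
      \<Longrightarrow> cmp C h (cmp C g f) = cmp C (cmp C h g) f"
    and ident_left: "f \<in> mors C \<Longrightarrow> cmp C (ident C (cod_of C f)) f = f"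
    and ident_right: "f \<in> mors C \<Longrightarrow> cmp C f (ident C (dom_of C f)) = f"
    and inverse_ex: "f \<in> mors C \<Longrightarrow> \<exists>g\<in>mors C. dom_of C g = cod_of C f \<and> cod_of C g = dom_of C f \<and>
      cmp C g f = ident C (dom_of C f) \<and> cmp C f g = ident C (cod_of C f)"

text \<open>An edge u together with a flag: \<open>(True, u)\<close> is u and \<open>(False, u)\<close> its formal inverse.
  Words are written in path order, so \<open>[e_1, e_2]\<close> stands for the composite \<open>e_2 \<circ> e_1\<close>.\<close>

type_synonym 'a sedge = "bool \<times> 'a"

definition sedge_src :: "'a sset \<Rightarrow> 'a sedge \<Rightarrow> 'a" where
  "sedge_src X e = (if fst e then face X 1 1 (snd e) else face X 1 0 (snd e))"

definition sedge_tgt :: "'a sset \<Rightarrow> 'a sedge \<Rightarrow> 'a" where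
  "sedge_tgt X e = (if fst e then face X 1 0 (snd e) else face X 1 1 (snd e))"

fun walk :: "'a sset \<Rightarrow> 'a \<Rightarrow> 'a sedge list \<Rightarrow> 'a \<Rightarrow> bool" where
  "walk X x [] y \<longleftrightarrow> x \<in> simps X 0 \<and> x = y"
| "walk X x (e # es) y \<longleftrightarrow> snd e \<in> simps X 1 \<and> sedge_src X e = x \<and> walk X (sedge_tgt X e) es y"

inductive basic_rel :: "'a sset \<Rightarrow> 'a sedge list \<Rightarrow> 'a sedge list \<Rightarrow> bool" for X where
  cancel: "u \<in> simps X 1 \<Longrightarrow> basic_rel X [(b, u), (\<not> b, u)] []"
| triangle: "\<sigma> \<in> simps X 2 \<Longrightarrow>
    basic_rel X [(True, face X 2 2 \<sigma>), (True, face X 2 0 \<sigma>)] [(True, face X 2 1 \<sigma>)]"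
| degenerate_edge: "v \<in> simps X 0 \<Longrightarrow> basic_rel X [(True, degen X 0 0 v)] []"

inductive walk_equiv :: "'a sset \<Rightarrow> 'a \<Rightarrow> 'a \<Rightarrow> 'a sedge list \<Rightarrow> 'a sedge list \<Rightarrow> bool" for X x y where
  walk_step: "\<lbrakk>basic_rel X l r; walk X x (p @ l @ q) y; walk X x (p @ r @ q) y\<rbrakk>
    \<Longrightarrow> walk_equiv X x y (p @ l @ q) (p @ r @ q)"
| walk_refl: "walk X x w y \<Longrightarrow> walk_equiv X x y w w"
| walk_sym: "walk_equiv X x y w w' \<Longrightarrow> walk_equiv X x y w' w"
| walk_trans: "\<lbrakk>walk_equiv X x y w w'; walk_equiv X x y w' w''\<rbrakk> \<Longrightarrow> walk_equiv X x y w w''"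

text \<open>A morphism is a triple of source, equivalence class of walks, and target.\<close>

type_synonym 'a pmor = "'a \<times> 'a sedge list set \<times> 'a"

definition walk_class :: "'a sset \<Rightarrow> 'a \<Rightarrow> 'a sedge list \<Rightarrow> 'a \<Rightarrow> 'a pmor" where
  "walk_class X x w y = (x, {w'. walk_equiv X x y w w'}, y)"

definition fundamental_groupoid :: "'a sset \<Rightarrow> ('a, 'a pmor) cat" where
  "fundamental_groupoid X =
    \<lparr>obs = simps X 0,
     mors = {walk_class X x w y | x w y. walk X x w y},
     dom_of = (\<lambda>(x, W, y). x),
     cod_of = (\<lambda>(x, W, y). y),
     ident = (\<lambda>x. walk_class X x [] x),
     cmp = (\<lambda>(y', V, z) (x, W, y). (x, {u. \<exists>w\<in>W. \<exists>v\<in>V. walk_equiv X x z (w @ v) u}, z))\<rparr>"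

definition flip :: "'a sedge list \<Rightarrow> 'a sedge list" where
  "flip w = rev (map (\<lambda>(b, u). (\<not> b, u)) w)"

context simplicial_set begin

lemma face_closed:
  assumes "x \<in> simps X n" "n \<ge> 1" "i \<le> n"
  shows "face X n i x \<in> simps X (n - 1)"
  unfolding face_def using assms
  by (intro oper_closed) (auto simp: ord_maps_def PiE_iff mono_on_def)

lemma degen_closed:
  assumes "x \<in> simps X n" "i \<le> n"
  shows "degen X n i x \<in> simps X (Suc n)"
  unfolding degen_def using assms
  by (intro oper_closed) (auto simp: ord_maps_def PiE_iff mono_on_def)

lemma sedge_ends:
  assumes "snd e \<in> simps X 1"
  shows "sedge_src X e \<in> simps X 0" "sedge_tgt X e \<in> simps X 0"
  using face_closed[OF assms, of 0] face_closed[OF assms, of 1]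
  by (auto simp: sedge_src_def sedge_tgt_def)

lemma walk_ends: "walk X x w y \<Longrightarrow> x \<in> simps X 0 \<and> y \<in> simps X 0"
proof (induction w arbitrary: x)
  case (Cons e w)
  then have "snd e \<in> simps X 1" "sedge_src X e = x" "walk X (sedge_tgt X e) w y" by auto
  then show ?case using Cons.IH sedge_ends(1) by blast
qed simp

lemma walk_append: "walk X x (u @ v) z \<longleftrightarrow> (\<exists>y. walk X x u y \<and> walk X y v z)"
proof (induction u arbitrary: x)
  case Nil
  then show ?case using walk_ends by auto
qed auto

lemma walk_equiv_walks: "walk_equiv X x y w w' \<Longrightarrow> walk X x w y \<and> walk X x w' y"
  by (induction rule: walk_equiv.induct) auto

lemma walk_equiv_append_right:
  assumes "walk_equiv X x y w w'" "walk X y v z"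
  shows "walk_equiv X x z (w @ v) (w' @ v)"
  using assms
proof (induction rule: walk_equiv.induct)
  case (walk_step l r p q)
  have "walk X x (p @ l @ q @ v) z" "walk X x (p @ r @ q @ v) z"
    using walk_step walk_append[of x "p @ l @ q" v z] walk_append[of x "p @ r @ q" v z] by auto
  from walk_equiv.walk_step[OF walk_step(1) this] show ?case by simp
next
  case (walk_refl w)
  then show ?case using walk_append by (blast intro: walk_equiv.walk_refl)
qed (blast intro: walk_equiv.intros)+

lemma walk_equiv_append_left:
  assumes "walk_equiv X y z w w'" "walk X x v y"
  shows "walk_equiv X x z (v @ w) (v @ w')"
  using assms
proof (induction rule: walk_equiv.induct)
  case (walk_step l r p q)
  have "walk X x ((v @ p) @ l @ q) z" "walk X x ((v @ p) @ r @ q) z"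
    using walk_step walk_append[of x v "p @ l @ q" z] walk_append[of x v "p @ r @ q" z] by auto
  from walk_equiv.walk_step[OF walk_step(1) this] show ?case by simp
next
  case (walk_refl w)
  then show ?case using walk_append by (blast intro: walk_equiv.walk_refl)
qed (blast intro: walk_equiv.intros)+

lemma walk_class_eq: "walk_equiv X x y w w' \<Longrightarrow> walk_class X x w y = walk_class X x w' y"
  unfolding walk_class_def by (blast intro: walk_equiv.walk_sym walk_equiv.walk_trans)

lemma comp_walk_class:
  assumes "walk X x w y" "walk X y v z"
  shows "cmp (fundamental_groupoid X) (walk_class X y v z) (walk_class X x w y)
    = walk_class X x (w @ v) z"
proof -
  have "walk_equiv X x z (w' @ v') u \<longleftrightarrow> walk_equiv X x z (w @ v) u"
    if "walk_equiv X x y w w'" "walk_equiv X y z v v'" for w' v' u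
  proof -
    have "walk_equiv X x z (w @ v) (w' @ v')"
    proof (rule walk_equiv.walk_trans)
      show "walk_equiv X x z (w @ v) (w' @ v)"
        using that(1) assms(2) by (rule walk_equiv_append_right)
      have "walk X x w' y" using that(1) walk_equiv_walks by blast
      then show "walk_equiv X x z (w' @ v) (w' @ v')"
        using that(2) walk_equiv_append_left by blast
    qed
    then show ?thesis by (blast intro: walk_equiv.walk_sym walk_equiv.walk_trans)
  qed
  moreover have "walk_equiv X x y w w" "walk_equiv X y z v v"
    using assms by (auto intro: walk_equiv.walk_refl)
  ultimately have "{u. \<exists>w'\<in>{w'. walk_equiv X x y w w'}. \<exists>v'\<in>{v'. walk_equiv X y z v v'}.
      walk_equiv X x z (w' @ v') u} = {u. walk_equiv X x z (w @ v) u}"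
    by (intro Collect_cong) blast
  then show ?thesis
    by (simp add: fundamental_groupoid_def walk_class_def)
qed

lemma walk_flip: "walk X x w y \<Longrightarrow> walk X y (flip w) x"
proof (induction w arbitrary: x)
  case Nil
  then show ?case by (auto simp: flip_def)
next
  case (Cons e w)
  obtain b u where e: "e = (b, u)" by force
  have "walk X (sedge_tgt X e) [(\<not> b, u)] x"
    using Cons.prems sedge_ends[of e] by (auto simp: e sedge_src_def sedge_tgt_def)
  then show ?case
    using Cons by (auto simp: flip_def e walk_append)
qed

lemma walk_flip_equiv: "walk X x w y \<Longrightarrow> walk_equiv X x x (w @ flip w) []"
proof (induction w arbitrary: x)
  case Nil
  then show ?case by (auto simp: flip_def intro: walk_equiv.walk_refl)
next
  case (Cons e w)
  obtain b u where e: "e = (b, u)" by force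
  let ?z = "sedge_tgt X e"
  have a: "walk X x [e] ?z" and b: "walk X ?z [(\<not> b, u)] x" and x: "x \<in> simps X 0"
    and u: "u \<in> simps X 1" and w: "walk X ?z w y"
    using Cons.prems sedge_ends[of e] by (auto simp: e sedge_src_def sedge_tgt_def)
  have "walk_equiv X x x ([e] @ (w @ flip w) @ [(\<not> b, u)]) ([e] @ [] @ [(\<not> b, u)])"
    using Cons.IH[OF w] a b walk_equiv_append_left walk_equiv_append_right by blast
  moreover have "walk_equiv X x x ([] @ [(b, u), (\<not> b, u)] @ []) ([] @ [] @ [])"
    using a b x u walk_append[of x "[e]" "[(\<not> b, u)]" x]
    by (intro walk_equiv.walk_step basic_rel.cancel) (auto simp: e)
  ultimately show ?case
    by (auto simp: flip_def e intro: walk_equiv.walk_trans)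
qed

lemma flip_flip: "flip (flip w) = w"
  by (induction w) (auto simp: flip_def)

lemma fundamental_groupoid_is_groupoid: "is_groupoid (fundamental_groupoid X)"
proof -
  let ?P = "fundamental_groupoid X"
  have ob: "obs ?P = simps X 0" by (simp add: fundamental_groupoid_def)
  have D: "dom_of ?P (walk_class X x w y) = x" "cod_of ?P (walk_class X x w y) = y" for x w y
    by (auto simp: fundamental_groupoid_def walk_class_def)
  have I: "ident ?P x = walk_class X x [] x" for x
    by (simp add: fundamental_groupoid_def)
  have M: "f \<in> mors ?P \<longleftrightarrow> (\<exists>x w y. f = walk_class X x w y \<and> walk X x w y)" for f
    by (auto simp: fundamental_groupoid_def)
  have C: "cmp ?P (walk_class X y v z) (walk_class X x w y) = walk_class X x (w @ v) z"
    if "walk X x w y" "walk X y v z" for x w y v z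
    using that by (rule comp_walk_class)
  have N: "walk X x [] x" if "x \<in> simps X 0" for x using that by simp
  have A: "walk X x (w @ v) z" if "walk X x w y" "walk X y v z" for x w y v z
    using that walk_append by blast
  show ?thesis
  proof
    fix f assume "f \<in> mors ?P"
    then obtain x w y where f: "f = walk_class X x w y" "walk X x w y" by (auto simp: M)
    then have e: "x \<in> simps X 0" "y \<in> simps X 0" using walk_ends by blast+
    show "dom_of ?P f \<in> obs ?P" "cod_of ?P f \<in> obs ?P"
      using f e by (auto simp: D ob)
    show "cmp ?P (ident ?P (cod_of ?P f)) f = f"
      unfolding f(1) D I using C[OF f(2) N[OF e(2)]] by simp
    show "cmp ?P f (ident ?P (dom_of ?P f)) = f"
      unfolding f(1) D I using C[OF N[OF e(1)] f(2)] by simp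
    let ?g = "walk_class X y (flip w) x"
    have "cmp ?P ?g f = ident ?P x" "cmp ?P f ?g = ident ?P y"
      unfolding f(1) I using C[OF f(2) walk_flip[OF f(2)]] C[OF walk_flip[OF f(2)] f(2)]
        walk_class_eq[OF walk_flip_equiv[OF f(2)]]
        walk_class_eq[OF walk_flip_equiv[OF walk_flip[OF f(2)]]]
      by (simp_all add: flip_flip)
    then show "\<exists>g\<in>mors ?P. dom_of ?P g = cod_of ?P f \<and> cod_of ?P g = dom_of ?P f \<and>
        cmp ?P g f = ident ?P (dom_of ?P f) \<and> cmp ?P f g = ident ?P (cod_of ?P f)"
      using walk_flip[OF f(2)] by (intro bexI[of _ ?g]) (auto simp: f(1) D M)
  next
    fix x assume "x \<in> obs ?P"
    then have "walk X x [] x" by (simp add: ob)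
    then show "ident ?P x \<in> mors ?P \<and> dom_of ?P (ident ?P x) = x \<and> cod_of ?P (ident ?P x) = x"
      by (auto simp only: I M D)
  next
    fix f g assume *: "f \<in> mors ?P" "g \<in> mors ?P" "cod_of ?P f = dom_of ?P g"
    then obtain x w y v z where "f = walk_class X x w y" "walk X x w y"
      "g = walk_class X y v z" "walk X y v z" by (auto simp: M D)
    moreover from this have "walk X x (w @ v) z" using A by blast
    then have "walk_class X x (w @ v) z \<in> mors ?P" using M by blast
    ultimately show "cmp ?P g f \<in> mors ?P \<and>
        dom_of ?P (cmp ?P g f) = dom_of ?P f \<and> cod_of ?P (cmp ?P g f) = cod_of ?P g"
      by (simp add: C D)
  next
    fix f g h assume *: "f \<in> mors ?P" "g \<in> mors ?P" "h \<in> mors ?P"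
      "cod_of ?P f = dom_of ?P g" "cod_of ?P g = dom_of ?P h"
    then obtain x w y v z u t where "f = walk_class X x w y" "walk X x w y"
      "g = walk_class X y v z" "walk X y v z" "h = walk_class X z u t" "walk X z u t"
      by (auto simp: M D)
    moreover from this have "walk X x (w @ v) z" "walk X y (v @ u) t" using A by blast+
    ultimately show "cmp ?P h (cmp ?P g f) = cmp ?P (cmp ?P h g) f"
      by (simp only: C append_assoc)
  qed
qed

end

definition edge_class :: "'a sset \<Rightarrow> 'a \<Rightarrow> 'a pmor" where
  "edge_class X u = walk_class X (face X 1 1 u) [(True, u)] (face X 1 0 u)"

text \<open>The unit of the adjunction between fundamental groupoid and nerve sends an n-simplex to a
  chain of n composable morphisms, encoded as its initial object and the list of the morphisms.\<close>

definition nerve_unit :: "'a sset \<Rightarrow> nat \<Rightarrow> 'a \<Rightarrow> 'a \<times> 'a pmor list" where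
  "nerve_unit X n x = (vert X n 0 x, map (edge_class X) (spine X n x))"


section \<open>Cohomology with local coefficients\<close>

record ('o, 'm, 'g) ab_fun =
  fob :: "'o \<Rightarrow> 'g monoid"
  fmor :: "'m \<Rightarrow> 'g \<Rightarrow> 'g"

definition functor_to_Ab :: "('o, 'm) cat \<Rightarrow> ('o, 'm, 'g) ab_fun \<Rightarrow> bool" where
  "functor_to_Ab C A \<longleftrightarrow>
     (\<forall>x\<in>obs C. comm_group (fob A x)) \<and>
     (\<forall>f\<in>mors C. fmor A f \<in> hom (fob A (dom_of C f)) (fob A (cod_of C f))) \<and>
     (\<forall>x\<in>obs C. \<forall>a\<in>carrier (fob A x). fmor A (ident C x) a = a) \<and>
     (\<forall>f\<in>mors C. \<forall>g\<in>mors C. cod_of C f = dom_of C g \<longrightarrow>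
        (\<forall>a\<in>carrier (fob A (dom_of C f)). fmor A (cmp C g f) a = fmor A g (fmor A f a)))"

definition local_coefficients :: "'a sset \<Rightarrow> ('a, 'a pmor, 'g) ab_fun \<Rightarrow> bool" where
  "local_coefficients X A \<longleftrightarrow> functor_to_Ab (fundamental_groupoid X) A"

definition base_group :: "'a sset \<Rightarrow> ('a, 'a pmor, 'g) ab_fun \<Rightarrow> nat \<Rightarrow> 'a \<Rightarrow> 'g monoid" where
  "base_group X A n x = fob A (fst (nerve_unit X n x))"

definition local_cochains :: "'a sset \<Rightarrow> ('a, 'a pmor, 'g) ab_fun \<Rightarrow> nat \<Rightarrow> ('a \<Rightarrow> 'g) monoid" where
  "local_cochains X A n =
     (let P = product_group (simps X n) (base_group X A n) in
      P\<lparr>carrier := {\<psi> \<in> carrier P.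
          \<forall>x\<in>simps X n. degenerate X n x \<longrightarrow> \<psi> x = \<one>\<^bsub>base_group X A n x\<^esub>}\<rparr>)"

text \<open>The map \<open>A(u_1)\<close> is an isomorphism from \<open>A(x_0)\<close> onto \<open>A(x_1)\<close>; \<open>inv_into\<close> yields its
  inverse.\<close>

definition local_coboundary ::
    "'a sset \<Rightarrow> ('a, 'a pmor, 'g) ab_fun \<Rightarrow> nat \<Rightarrow> ('a \<Rightarrow> 'g) \<Rightarrow> 'a \<Rightarrow> 'g" where
  "local_coboundary X A n \<psi> =
     (\<lambda>x\<in>simps X (Suc n).
        let B = base_group X A (Suc n) x;
            u1 = hd (snd (nerve_unit X (Suc n) x))
        in inv_into (carrier B) (fmor A u1) (\<psi> (face X (Suc n) 0 x)) \<otimes>\<^bsub>B\<^esub>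
           (\<Otimes>\<^bsub>B\<^esub>i\<in>{1..Suc n}. \<psi> (face X (Suc n) i x) [^]\<^bsub>B\<^esub> ((-1) ^ i :: int)))"

definition local_cohomology ::
    "'a sset \<Rightarrow> ('a, 'a pmor, 'g) ab_fun \<Rightarrow> nat \<Rightarrow> ('a \<Rightarrow> 'g) set monoid" where
  "local_cohomology X A n = cohomology (local_cochains X A) (local_coboundary X A) n"

definition induced_coefficients ::
    "'a sset \<Rightarrow> 'g monoid \<Rightarrow> (nat \<Rightarrow> 'a \<Rightarrow> ('g \<Rightarrow> 'g) list) \<Rightarrow> ('a, 'a pmor, 'g) ab_fun \<Rightarrow> bool" where
  "induced_coefficients M G \<phi> A \<longleftrightarrow>
     local_coefficients M A \<and>
     (\<forall>p\<in>simps M 0. fob A p = G) \<and>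
     (\<forall>x\<in>simps M 1. \<forall>g\<in>carrier G. fmor A (edge_class M x) g = (inv\<^bsub>AutoGroup G\<^esub> (act \<phi> x)) g)"

text \<open>Existence of the functor: walks are evaluated as products of their signed edges.\<close>

fun walk_val :: "'g monoid \<Rightarrow> (nat \<Rightarrow> 'a \<Rightarrow> ('g \<Rightarrow> 'g) list) \<Rightarrow> 'a sedge list \<Rightarrow> 'g \<Rightarrow> 'g" where
  "walk_val G \<phi> [] = \<one>\<^bsub>AutoGroup G\<^esub>"
| "walk_val G \<phi> (e # w) = walk_val G \<phi> w \<otimes>\<^bsub>AutoGroup G\<^esub>
     (if fst e then inv\<^bsub>AutoGroup G\<^esub> act \<phi> (snd e) else act \<phi> (snd e))"

lemma induced_coefficients_exist:
  fixes M :: "'a sset" and G :: "'g monoid"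
  assumes "partial_group M \<nu>" "comm_group G" "partial_action M G \<phi>"
  shows "\<exists>A. induced_coefficients M G \<phi> A"
proof -
  interpret M: partial_group M \<nu> by fact
  interpret G: comm_group G by fact
  let ?H = "AutoGroup G"
  interpret H: group ?H by (rule G.AutoGroup)
  interpret B: simplicial_set "bar ?H" by (rule H.bar_simplicial_set)
  let ?P = "fundamental_groupoid M"
  let ?v = "walk_val G \<phi>"
  have phi: "\<phi> n x \<in> simps (bar ?H) n" if "x \<in> simps M n" for n x
    using assms(3) that by (auto simp: partial_action_def simplicial_map_def)
  have nat: "\<phi> m (oper M m n \<theta> x) = oper (bar ?H) m n \<theta> (\<phi> n x)"
    if "\<theta> \<in> ord_maps m n" "x \<in> simps M n" for m n \<theta> x
    using assms(3) that by (auto simp: partial_action_def simplicial_map_def)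
  have act1: "act \<phi> x \<in> carrier ?H" if "x \<in> simps M 1" for x
    using phi[OF that] unfolding act_def bar_def by (cases "\<phi> 1 x") auto
  have actd: "act \<phi> (face M 2 1 \<sigma>) = act \<phi> (face M 2 2 \<sigma>) \<otimes>\<^bsub>?H\<^esub> act \<phi> (face M 2 0 \<sigma>)"
    if s: "\<sigma> \<in> simps M 2" for \<sigma>
  proof -
    obtain a b where ab: "\<phi> 2 \<sigma> = [a, b]" "a \<in> carrier ?H" "b \<in> carrier ?H"
      using phi[OF s] by (auto simp: bar_def length_Suc_conv numeral_2_eq_2)
    have d: "\<phi> 1 (face M 2 i \<sigma>) = face (bar ?H) 2 i [a, b]" if "i \<le> 2" for i
    proof -
      have "(\<lambda>j\<in>{..1}. if j < i then j else Suc j) \<in> ord_maps 1 2"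
        by (auto simp: ord_maps_def PiE_iff mono_on_def)
      from nat[OF this s] show ?thesis by (simp add: face_def ab(1))
    qed
    show ?thesis
      using d[of 0] d[of 1] d[of 2] ab
      by (simp add: act_def face_def bar_def seg_prod_def upt_rec)
  qed
  have acts: "act \<phi> (degen M 0 0 p) = \<one>\<^bsub>?H\<^esub>" if p: "p \<in> simps M 0" for p
  proof -
    have "(\<lambda>j\<in>{..Suc 0}. if j \<le> 0 then j else j - 1) \<in> ord_maps 1 0"
      by (auto simp: ord_maps_def PiE_iff mono_on_def)
    from nat[OF this p] show ?thesis by (simp add: act_def degen_def bar_def)
  qed
  have vc: "?v w \<in> carrier ?H" if "\<forall>e\<in>set w. snd e \<in> simps M 1" for w
    using that by (induction w) (auto simp: act1)
  have wset: "\<forall>e\<in>set w. snd e \<in> simps M 1" if "walk M x w y" for x w y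
    using that by (induction w arbitrary: x) auto
  have vapp: "?v (w @ u) = ?v u \<otimes>\<^bsub>?H\<^esub> ?v w"
    if "\<forall>e\<in>set (w @ u). snd e \<in> simps M 1" for w u
    using that by (induction w) (auto simp: act1 vc H.m_assoc)
  have vb: "?v l = ?v r" if "basic_rel M l r" for l r
    using that
  proof cases
    case (cancel u b)
    then show ?thesis by (auto simp: act1)
  next
    case (triangle \<sigma>)
    have "face M 2 i \<sigma> \<in> simps M 1" if "i \<le> 2" for i
      using M.face_closed[OF triangle(3), of i] that by simp
    then show ?thesis
      using triangle act1 actd[OF triangle(3)] by (simp add: H.inv_mult_group)
  next
    case (degenerate_edge p)
    then show ?thesis by (simp add: acts)
  qed
  have vinv: "?v w = ?v w'" if "walk_equiv M x y w w'" for x y w w'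
    using that
  proof (induction rule: walk_equiv.induct)
    case (walk_step l r p q)
    have "\<forall>e\<in>set (p @ l @ q). snd e \<in> simps M 1" "\<forall>e\<in>set (p @ r @ q). snd e \<in> simps M 1"
      using walk_step wset by blast+
    then show ?case using vb[OF walk_step(1)] by (simp add: vapp)
  qed auto
  define F where "F = (\<lambda>(x :: 'a, W, y :: 'a). ?v (SOME w. w \<in> W))"
  have F: "F (walk_class M x w y) = ?v w" if "walk M x w y" for x w y
  proof -
    have "walk_equiv M x y w (SOME w'. walk_equiv M x y w w')"
      by (rule someI[of _ w]) (rule walk_equiv.walk_refl[OF that])
    then show ?thesis using vinv by (auto simp: F_def walk_class_def)
  qed
  have car: "f \<in> hom G G" if "f \<in> carrier ?H" for f
    using that by (simp add: AutoGroup_def auto_def)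
  have mul: "(f \<otimes>\<^bsub>?H\<^esub> g) a = f (g a)" if "f \<in> carrier ?H" "g \<in> carrier ?H" "a \<in> carrier G" for f g a
    using that by (auto simp: AutoGroup_def auto_def BijGroup_def compose_def)
  have idn: "\<one>\<^bsub>?H\<^esub> a = a" if "a \<in> carrier G" for a
    using that by (auto simp: AutoGroup_def BijGroup_def)
  let ?A = "\<lparr>fob = (\<lambda>_ :: 'a. G), fmor = F\<rparr>"
  have "functor_to_Ab ?P ?A"
    unfolding functor_to_Ab_def
  proof (intro conjI ballI impI)
    show "comm_group (fob ?A x)" for x by (simp add: assms)
    fix f assume "f \<in> mors ?P"
    then obtain x w y where f: "f = walk_class M x w y" "walk M x w y"
      by (auto simp: fundamental_groupoid_def)
    then show "fmor ?A f \<in> hom (fob ?A (dom_of ?P f)) (fob ?A (cod_of ?P f))"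
      using car vc wset by (simp add: F)
    fix g a assume "g \<in> mors ?P" "cod_of ?P f = dom_of ?P g" "a \<in> carrier (fob ?A (dom_of ?P f))"
    then obtain v z where g: "g = walk_class M y v z" "walk M y v z" and a: "a \<in> carrier G"
      using f by (auto simp: fundamental_groupoid_def walk_class_def)
    have "walk M x (w @ v) z" using f g M.walk_append by blast
    then have "F (cmp ?P g f) = ?v v \<otimes>\<^bsub>?H\<^esub> ?v w"
      using f g wset M.comp_walk_class vapp by (simp add: F)
    then show "fmor ?A (cmp ?P g f) a = fmor ?A g (fmor ?A f a)"
      using f g a vc wset by (simp add: F mul)
  next
    fix x a assume "x \<in> obs ?P" "a \<in> carrier (fob ?A x)"
    then have x: "walk M x [] x" and a: "a \<in> carrier G" by (auto simp: fundamental_groupoid_def)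
    then show "fmor ?A (ident ?P x) a = a"
      using F[OF x] idn by (simp add: fundamental_groupoid_def)
  qed
  moreover have "fmor ?A (edge_class M x) g = (inv\<^bsub>?H\<^esub> (act \<phi> x)) g" if "x \<in> simps M 1" for x g
  proof -
    have "walk M (face M 1 1 x) [(True, x)] (face M 1 0 x)"
      using that M.sedge_ends[of "(True, x)"] by (auto simp: sedge_src_def sedge_tgt_def)
    from F[OF this] show ?thesis using act1[OF that] by (simp add: edge_class_def)
  qed
  ultimately have "induced_coefficients M G \<phi> ?A"
    by (simp add: induced_coefficients_def local_coefficients_def)
  then show ?thesis by blast
qed

end

theory Submission
  imports Defs
begin

text \<open>
  Both sides are computed from nearly the same complex.  Since \<open>M\<close> has a single vertex, all
  coefficient groups of \<open>A\<close> are \<open>G\<close>, and since \<open>A(x) = \<phi>(x)\<^sup>-\<^sup>1\<close>, the inverse of \<open>A(u_1)\<close> in the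
  coboundary with local coefficients is the action \<open>\<phi>(x_1)\<close> in the coboundary of generalized
  group cohomology (\<open>local_coboundary_eq\<close>).  The difference is that cochains with local
  coefficients are normalized, while all cochains are admitted in \<open>C_\<phi>\<close>.  So the theorem says that
  the inclusion of the normalized cochains is a quasi-isomorphism.

  This holds for every cosimplicial abelian group, and the proof takes that generality.  Let
  \<open>\<delta> \<psi>\<close> be normalized and let the codegeneracies \<open>s_0, \<dots>, s_{p-1}\<close> kill \<open>\<psi>\<close>.  Written additively,
  the cosimplicial identities give \<open>s_p (\<delta> (s_p \<psi>)) = (-1)\<^sup>p s_p \<psi>\<close> (\<open>s_coboundary_s\<close>), so that
  \<open>s_0, \<dots>, s_p\<close> kill \<open>\<psi> - (-1)\<^sup>p \<delta> (s_p \<psi>)\<close>, which has the same coboundary as \<open>\<psi>\<close>.  Iterating, every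
  cochain with normalized coboundary is normalized up to a coboundary.  For cocycles this gives
  surjectivity on cohomology, and for cochains whose coboundary is a given normalized cochain
  it gives injectivity (\<open>cohomology_subcomplex_iso\<close>).

  That twisted cochains form a cosimplicial group is seen by treating all simplicial operators
  at once: an operator \<open>\<theta>\<close> sends \<open>\<psi>\<close> to the cochain whose value at \<open>x\<close> is \<open>\<psi>(\<theta>\<^sup>*x)\<close>, moved by the
  action of the edge of \<open>x\<close> from vertex 0 to vertex \<open>\<theta> 0\<close>.  Functoriality is then the
  multiplicativity of \<open>\<phi>\<close> on spines (\<open>transport_comp\<close>).
\<close>

section \<open>Cohomology of a subcomplex\<close>

text \<open>Second isomorphism theorem: since \<open>H\<close> meets every coset of \<open>B\<close>, the
  quotient map is already surjective on \<open>H\<close>, and its kernel there is \<open>B \<inter> H\<close>.\<close>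

lemma (in comm_group) FactGroup_iso_subgroup:
  assumes B: "subgroup B G" and H: "subgroup H G"
    and meet: "\<And>x. x \<in> carrier G \<Longrightarrow> \<exists>b\<in>B. x \<otimes> b \<in> H"
  shows "G Mod B \<cong> G\<lparr>carrier := H\<rparr> Mod (B \<inter> H)"
proof -
  let ?K = "G\<lparr>carrier := H\<rparr>" and ?q = "\<lambda>x. B #> x"
  interpret B: normal B G using B by (rule subgroup_imp_normal)
  interpret K: group ?K using H subgroup_imp_group by blast
  have HG: "x \<in> carrier G" if "x \<in> H" for x using subgroup.mem_carrier[OF H that] .
  have "?q \<in> hom ?K (G Mod B)"
    using hom_mult[OF B.r_coset_hom_Mod] HG by (intro homI) (auto simp: carrier_FactGroup)
  then interpret q: group_hom ?K "G Mod B" ?q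
    by (simp add: group_hom_def group_hom_axioms_def K.group_axioms B.factorgroup_is_group)
  have "kernel ?K (G Mod B) ?q = B \<inter> H"
    using HG coset_join1[OF _ _ B] coset_join2[OF _ B] by (auto simp: kernel_def)
  moreover have "?q ` carrier ?K = carrier (G Mod B)"
  proof -
    have "B #> x \<in> ?q ` H" if x: "x \<in> carrier G" for x
    proof -
      obtain b where b: "b \<in> B" "x \<otimes> b \<in> H" using meet x by blast
      then have "x \<otimes> b \<in> B #> x"
        using x B.mem_carrier m_comm[of x b] by (auto simp: r_coset_def)
      then have "B #> x = B #> (x \<otimes> b)" using x B by (intro repr_independence)
      then show ?thesis using b by blast
    qed
    then show ?thesis using HG by (auto simp: carrier_FactGroup)
  qed
  ultimately have "?K Mod (B \<inter> H) \<cong> G Mod B" using q.FactGroup_iso by metis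
  moreover have "group (?K Mod (B \<inter> H))"
    using \<open>kernel ?K (G Mod B) ?q = B \<inter> H\<close> q.normal_kernel normal.factorgroup_is_group by metis
  ultimately show ?thesis using group.iso_sym by blast
qed

definition coboundaries :: "(nat \<Rightarrow> 'c monoid) \<Rightarrow> (nat \<Rightarrow> 'c \<Rightarrow> 'c) \<Rightarrow> nat \<Rightarrow> 'c set" where
  "coboundaries C \<delta> n = (if n = 0 then {\<one>\<^bsub>C n\<^esub>} else \<delta> (n - 1) ` carrier (C (n - 1)))"

lemma cohomology_eq:
  "cohomology C \<delta> n = (C n)\<lparr>carrier := kernel (C n) (C (Suc n)) (\<delta> n)\<rparr> Mod coboundaries C \<delta> n"
  by (simp add: cohomology_def coboundaries_def)

locale cochain_complex =
  fixes C :: "nat \<Rightarrow> 'c monoid" and \<delta> :: "nat \<Rightarrow> 'c \<Rightarrow> 'c"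
  assumes cochains: "comm_group (C n)"
    and coboundary_hom: "\<delta> n \<in> hom (C n) (C (Suc n))"
    and coboundary_coboundary: "\<psi> \<in> carrier (C n) \<Longrightarrow> \<delta> (Suc n) (\<delta> n \<psi>) = \<one>\<^bsub>C (Suc (Suc n))\<^esub>"
begin

lemma coboundary_group_hom: "group_hom (C n) (C (Suc n)) (\<delta> n)"
  using cochains coboundary_hom
  by (simp add: group_hom_def group_hom_axioms_def comm_group.axioms)

lemma coboundaries_subset: "coboundaries C \<delta> n \<subseteq> kernel (C n) (C (Suc n)) (\<delta> n)"
proof (cases n)
  case 0
  then show ?thesis
    using group_hom.subgroup_kernel[OF coboundary_group_hom] subgroup.one_closed
    by (fastforce simp: coboundaries_def)
next
  case (Suc m)
  then show ?thesis
    using coboundary_hom[of m] coboundary_coboundary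
    by (auto simp: coboundaries_def kernel_def hom_def)
qed

lemma subgroup_coboundaries: "subgroup (coboundaries C \<delta> n) (C n)"
proof (cases n)
  case 0
  then show ?thesis
    using cochains[of n] by (simp add: coboundaries_def comm_group.axioms group.triv_subgroup)
next
  case (Suc m)
  then show ?thesis
    using group_hom.img_is_subgroup[OF coboundary_group_hom[of m]] by (simp add: coboundaries_def)
qed

text \<open>The hypothesis \<open>deform\<close> is used in two degrees.  For a cocycle \<open>\<psi>\<close> it says that
  the class of \<open>\<psi>\<close> has a representative in \<open>N\<close>.  For \<open>\<chi>\<close> with \<open>\<delta> \<chi>\<close> in \<open>N\<close> it replaces \<open>\<chi>\<close> by
  an element of \<open>N\<close> with the same coboundary, so that a cochain of \<open>N\<close> which bounds in \<open>C\<close>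
  bounds in \<open>N\<close>.\<close>

theorem cohomology_subcomplex_iso:
  assumes N: "\<And>n. subgroup (N n) (C n)"
    and closed: "\<And>n \<psi>. \<psi> \<in> N n \<Longrightarrow> \<delta> n \<psi> \<in> N (Suc n)"
    and \<epsilon>: "\<And>n \<psi>. \<psi> \<in> N n \<Longrightarrow> \<epsilon> n \<psi> = \<delta> n \<psi>"
    and deform: "\<And>n \<psi>. \<psi> \<in> carrier (C n) \<Longrightarrow> \<delta> n \<psi> \<in> N (Suc n) \<Longrightarrow>
      \<exists>b\<in>coboundaries C \<delta> n. \<psi> \<otimes>\<^bsub>C n\<^esub> b \<in> N n"
  shows "cohomology C \<delta> n \<cong> cohomology (\<lambda>n. (C n)\<lparr>carrier := N n\<rparr>) \<epsilon> n"
proof -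
  let ?N = "\<lambda>n. (C n)\<lparr>carrier := N n\<rparr>"
  let ?Z = "\<lambda>n. kernel (C n) (C (Suc n)) (\<delta> n)" and ?B = "coboundaries C \<delta>"
  interpret C: comm_group "C n" by (rule cochains)
  interpret d: group_hom "C n" "C (Suc n)" "\<delta> n" by (rule coboundary_group_hom)
  have Z: "subgroup (?Z n) (C n)" by (rule d.subgroup_kernel)
  interpret Z: comm_group "C n\<lparr>carrier := ?Z n\<rparr>"
  proof (rule group.group_comm_groupI)
    show "group (C n\<lparr>carrier := ?Z n\<rparr>)" using Z by (rule C.subgroup_imp_group)
  qed (use subgroup.mem_carrier[OF Z] C.m_comm in simp)
  have NC: "\<psi> \<in> carrier (C k)" if "\<psi> \<in> N k" for k \<psi>
    using subgroup.mem_carrier[OF N that] .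
  have ZN: "kernel (?N n) (?N (Suc n)) (\<epsilon> n) = ?Z n \<inter> N n"
    using NC \<epsilon> by (auto simp: kernel_def)
  have "coboundaries ?N \<epsilon> n = ?B n \<inter> (?Z n \<inter> N n)"
  proof
    show "coboundaries ?N \<epsilon> n \<subseteq> ?B n \<inter> (?Z n \<inter> N n)"
    proof -
      have "coboundaries ?N \<epsilon> n \<subseteq> ?B n"
        using NC \<epsilon> by (auto simp: coboundaries_def)
      moreover have "coboundaries ?N \<epsilon> n \<subseteq> N n"
      proof (cases n)
        case 0
        then show ?thesis using N[of n] by (simp add: coboundaries_def subgroup.one_closed)
      next
        case (Suc m)
        then show ?thesis using closed[of _ m] \<epsilon> by (auto simp: coboundaries_def)
      qed
      ultimately show ?thesis using coboundaries_subset by blast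
    qed
    show "?B n \<inter> (?Z n \<inter> N n) \<subseteq> coboundaries ?N \<epsilon> n"
    proof (cases n)
      case 0
      then show ?thesis by (auto simp: coboundaries_def)
    next
      case (Suc m)
      interpret D: group_hom "C m" "C (Suc m)" "\<delta> m" by (rule coboundary_group_hom)
      show ?thesis
      proof
        fix \<psi> assume "\<psi> \<in> ?B n \<inter> (?Z n \<inter> N n)"
        then obtain \<chi> where \<chi>: "\<chi> \<in> carrier (C m)" "\<psi> = \<delta> m \<chi>" "\<delta> m \<chi> \<in> N (Suc m)"
          using Suc by (auto simp: coboundaries_def)
        then obtain b where b: "b \<in> ?B m" "\<chi> \<otimes>\<^bsub>C m\<^esub> b \<in> N m"
          using deform by blast
        then have "b \<in> carrier (C m)" "\<delta> m b = \<one>\<^bsub>C (Suc m)\<^esub>"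
          using coboundaries_subset by (auto simp: kernel_def)
        then have "\<psi> = \<epsilon> m (\<chi> \<otimes>\<^bsub>C m\<^esub> b)"
          using \<chi> b \<epsilon> by simp
        then show "\<psi> \<in> coboundaries ?N \<epsilon> n"
          using b Suc by (auto simp: coboundaries_def)
      qed
    qed
  qed
  moreover have "subgroup (?B n) (C n\<lparr>carrier := ?Z n\<rparr>)"
    using subgroup_coboundaries Z coboundaries_subset C.subgroup_incl by blast
  moreover have "subgroup (?Z n \<inter> N n) (C n\<lparr>carrier := ?Z n\<rparr>)"
    using C.subgroups_Inter_pair[OF Z N] Z C.subgroup_incl by blast
  moreover have "\<exists>b\<in>?B n. \<psi> \<otimes>\<^bsub>C n\<^esub> b \<in> ?Z n \<inter> N n" if "\<psi> \<in> ?Z n" for \<psi>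
  proof -
    have "\<psi> \<in> carrier (C n)" "\<delta> n \<psi> \<in> N (Suc n)"
      using that N[of "Suc n"] by (auto simp: kernel_def subgroup.one_closed)
    then obtain b where "b \<in> ?B n" "\<psi> \<otimes>\<^bsub>C n\<^esub> b \<in> N n" using deform by blast
    then show ?thesis
      using that coboundaries_subset subgroup.m_closed[OF Z] by blast
  qed
  ultimately show ?thesis
    using Z.FactGroup_iso_subgroup[of "?B n" "?Z n \<inter> N n"]
    by (simp add: cohomology_eq ZN)
qed

end

section \<open>Alternating products\<close>

definition alt_prod :: "('g, 'b) monoid_scheme \<Rightarrow> (nat \<Rightarrow> 'g) \<Rightarrow> nat \<Rightarrow> 'g" where
  "alt_prod G g n = (\<Otimes>\<^bsub>G\<^esub>i\<in>{..n}. g i [^]\<^bsub>G\<^esub> ((-1) ^ i :: int))"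

context comm_group begin

lemma alt_prod_0: "g 0 \<in> carrier G \<Longrightarrow> alt_prod G g 0 = g 0"
  by (simp add: alt_prod_def)

lemma alt_prod_closed:
  "(\<And>i. i \<le> n \<Longrightarrow> g i \<in> carrier G) \<Longrightarrow> alt_prod G g n \<in> carrier G"
  unfolding alt_prod_def by (intro finprod_closed) auto

lemma alt_prod_Suc:
  "(\<And>i. i \<le> Suc n \<Longrightarrow> g i \<in> carrier G) \<Longrightarrow>
    alt_prod G g (Suc n) = alt_prod G g n \<otimes> g (Suc n) [^] ((-1) ^ Suc n :: int)"
  unfolding alt_prod_def by (subst finprod_Suc) (auto intro!: m_comm finprod_closed)

lemma alt_prod_cong:
  "(\<And>i. i \<le> n \<Longrightarrow> g i \<in> carrier G) \<Longrightarrow> (\<And>i. i \<le> n \<Longrightarrow> f i = g i) \<Longrightarrow>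
    alt_prod G f n = alt_prod G g n"
  unfolding alt_prod_def by (intro finprod_cong') auto

lemma alt_prod_mult:
  "(\<And>i. i \<le> n \<Longrightarrow> f i \<in> carrier G) \<Longrightarrow> (\<And>i. i \<le> n \<Longrightarrow> g i \<in> carrier G) \<Longrightarrow>
    alt_prod G (\<lambda>i. f i \<otimes> g i) n = alt_prod G f n \<otimes> alt_prod G g n"
proof -
  assume f: "\<And>i. i \<le> n \<Longrightarrow> f i \<in> carrier G" and g: "\<And>i. i \<le> n \<Longrightarrow> g i \<in> carrier G"
  let ?e = "\<lambda>i. (-1) ^ i :: int"
  have "alt_prod G (\<lambda>i. f i \<otimes> g i) n = (\<Otimes>i\<in>{..n}. f i [^] ?e i \<otimes> g i [^] ?e i)"
    unfolding alt_prod_def using f g by (intro finprod_cong') (auto simp: int_pow_distrib)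
  also have "\<dots> = alt_prod G f n \<otimes> alt_prod G g n"
    unfolding alt_prod_def using f g by (intro finprod_multf) auto
  finally show ?thesis .
qed

lemma sign_Suc_cancel:
  "x \<in> carrier G \<Longrightarrow> x [^] ((-1) ^ Suc n :: int) = inv (x [^] ((-1) ^ n :: int))"
  by (simp add: int_pow_neg)

lemma sign_hom: "(\<lambda>x. x [^] (k :: int)) \<in> hom G G"
  by (auto simp: hom_def int_pow_distrib)

lemma hom_alt_prod:
  assumes "h \<in> hom G H" "comm_group H" "\<And>i. i \<le> n \<Longrightarrow> g i \<in> carrier G"
  shows "h (alt_prod G g n) = alt_prod H (\<lambda>i. h (g i)) n"
proof -
  interpret H: comm_group H by fact
  interpret h: group_hom G H h
    using assms by (simp add: group_hom_def group_hom_axioms_def group_axioms H.group_axioms)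
  show ?thesis
    using assms(3)
  proof (induction n)
    case 0
    then show ?case by (simp add: alt_prod_0 H.alt_prod_0)
  next
    case (Suc n)
    then show ?case
      by (simp add: alt_prod_Suc H.alt_prod_Suc alt_prod_closed h.hom_int_pow del: power_Suc)
  qed
qed

text \<open>The two equal entries stand next to each other and so occur with opposite signs.\<close>

lemma alt_prod_pair:
  assumes "\<And>i. i \<le> n \<Longrightarrow> g i \<in> carrier G" "j < n" "g (Suc j) = g j"
    and "\<And>i. i \<le> n \<Longrightarrow> i \<noteq> j \<Longrightarrow> i \<noteq> Suc j \<Longrightarrow> g i = \<one>"
  shows "alt_prod G g n = \<one>"
proof -
  have "alt_prod G g m = (if m = j then g j [^] ((-1) ^ j :: int) else \<one>)" if "m \<le> n" for m
    using that
  proof (induction m)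
    case 0
    then show ?case using assms by (auto simp: alt_prod_0)
  next
    case (Suc m)
    have "j < n \<Longrightarrow> g j \<in> carrier G" using assms by simp
    with Suc show ?case
      using assms by (auto simp: alt_prod_Suc sign_Suc_cancel simp del: power_Suc)
  qed
  then show ?thesis using assms(2) by simp
qed

text \<open>The shift by one position reverses the signs, so every factor of the second product from
  position \<open>p\<close> on cancels against one of the first, and only the entry \<open>a p\<close> is left over.\<close>

lemma alt_prod_shift:
  assumes "\<And>i. i \<le> Suc n \<Longrightarrow> a i \<in> carrier G" "\<And>i. i \<le> n \<Longrightarrow> b i \<in> carrier G"
    and "\<And>i. i \<le> n \<Longrightarrow> p \<le> i \<Longrightarrow> a (Suc i) = b i"
    and "\<And>i. i \<le> Suc n \<Longrightarrow> i < p \<Longrightarrow> a i = \<one>" "\<And>i. i \<le> n \<Longrightarrow> i < p \<Longrightarrow> b i = \<one>"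
    and "p \<le> Suc n"
  shows "alt_prod G a (Suc n) \<otimes> alt_prod G b n = a p [^] ((-1) ^ p :: int)"
proof -
  have "alt_prod G a (Suc m) \<otimes> alt_prod G b m
      = (if p \<le> Suc m then a p [^] ((-1) ^ p :: int) else \<one>)" if "m \<le> n" for m
    using that
  proof (induction m)
    case 0
    consider "p = 0" | "p = 1" | "p > 1" by linarith
    then show ?case
      using 0 assms by cases (auto simp: alt_prod_Suc alt_prod_0 int_pow_neg m_assoc)
  next
    case (Suc m)
    define A B x y where AB: "A = alt_prod G a (Suc m)" "B = alt_prod G b m"
      "x = a (Suc (Suc m)) [^] ((-1) ^ Suc (Suc m) :: int)" "y = b (Suc m) [^] ((-1) ^ Suc m :: int)"
    have c: "A \<in> carrier G" "B \<in> carrier G" "x \<in> carrier G" "y \<in> carrier G"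
      using Suc.prems assms(1,2) by (auto simp: AB intro!: alt_prod_closed)
    have "alt_prod G a (Suc (Suc m)) \<otimes> alt_prod G b (Suc m) = (A \<otimes> x) \<otimes> (B \<otimes> y)"
      using Suc.prems assms(1,2) by (simp add: alt_prod_Suc AB del: power_Suc)
    also have "\<dots> = (A \<otimes> B) \<otimes> (x \<otimes> y)" using c by (simp add: m_ac)
    finally have e: "alt_prod G a (Suc (Suc m)) \<otimes> alt_prod G b (Suc m) = (A \<otimes> B) \<otimes> (x \<otimes> y)" .
    have IH: "A \<otimes> B = (if p \<le> Suc m then a p [^] ((-1) ^ p :: int) else \<one>)"
      using Suc by (simp add: AB)
    consider "p \<le> Suc m" | "p = Suc (Suc m)" | "p > Suc (Suc m)" by linarith
    then show ?case
    proof cases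
      case 1
      then have "x \<otimes> y = \<one>"
        using Suc.prems assms(2,3)[of "Suc m"]
        unfolding AB by (subst sign_Suc_cancel) (auto simp del: power_Suc)
      then show ?thesis using 1 c Suc.prems assms(1)[of p] unfolding e IH by simp
    next
      case 2
      then have "y = \<one>" using Suc.prems assms(5)[of "Suc m"] by (simp add: AB)
      then show ?thesis using 2 c Suc.prems unfolding e IH by (simp add: AB)
    next
      case 3
      then have "x = \<one>" "y = \<one>"
        using Suc.prems assms(4)[of "Suc (Suc m)"] assms(5)[of "Suc m"] by (simp_all add: AB)
      then show ?thesis using 3 unfolding e IH by simp
    qed
  qed
  then show ?thesis using assms(6) by simp
qed

text \<open>This is the computation behind \<open>\<delta> \<circ> \<delta> = 0\<close>: the symmetry pairs the entry \<open>(j, i)\<close> with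
  \<open>(i, j - 1)\<close>, which has the opposite sign.  In the induction, the row and the column that
  are added last are paired with each other.\<close>

lemma alt_prod_alt_prod:
  assumes "\<And>i j. i \<le> n \<Longrightarrow> j \<le> Suc n \<Longrightarrow> a j i \<in> carrier G"
    and "\<And>i j. i < j \<Longrightarrow> j \<le> Suc n \<Longrightarrow> a j i = a i (j - 1)"
  shows "alt_prod G (\<lambda>j. alt_prod G (a j) n) (Suc n) = \<one>"
proof -
  have "alt_prod G (\<lambda>j. alt_prod G (a j) m) (Suc m) = \<one>" if "m \<le> n" for m
    using that
  proof (induction m)
    case 0
    have "a 1 0 = a 0 0" using assms(2)[of 0 1] by simp
    then show ?case
      using assms(1)[of 0 0] 0 assms(1)[of 0 1]
      by (simp add: alt_prod_def[of _ _ "Suc 0"] atMost_Suc alt_prod_0 int_pow_neg)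
  next
    case (Suc m)
    let ?k = "Suc (Suc m)" and ?c = "\<lambda>j. a j (Suc m)"
    let ?e = "(-1) ^ Suc m :: int"
    have c: "a j i \<in> carrier G" if "i \<le> Suc m" "j \<le> ?k" for i j
      using assms(1) that Suc.prems by simp
    have "alt_prod G (\<lambda>j. alt_prod G (a j) (Suc m)) ?k
        = alt_prod G (\<lambda>j. alt_prod G (a j) (Suc m)) (Suc m) \<otimes> alt_prod G (a ?k) (Suc m) [^] ((-1) ^ ?k :: int)"
      using c by (intro alt_prod_Suc alt_prod_closed) auto
    also have "alt_prod G (a ?k) (Suc m) = alt_prod G ?c (Suc m)"
      using c assms(2)[of _ ?k] Suc.prems by (intro alt_prod_cong) auto
    also have "alt_prod G (\<lambda>j. alt_prod G (a j) (Suc m)) (Suc m)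
        = alt_prod G (\<lambda>j. alt_prod G (a j) m \<otimes> ?c j [^] ?e) (Suc m)"
      using c by (intro alt_prod_cong) (auto intro!: alt_prod_Suc alt_prod_closed simp del: power_Suc)
    also have "\<dots> = alt_prod G (\<lambda>j. alt_prod G (a j) m) (Suc m) \<otimes> alt_prod G (\<lambda>j. ?c j [^] ?e) (Suc m)"
      using c by (intro alt_prod_mult) (auto intro!: alt_prod_closed)
    also have "alt_prod G (\<lambda>j. alt_prod G (a j) m) (Suc m) = \<one>" using Suc by simp
    also have "alt_prod G (\<lambda>j. ?c j [^] ?e) (Suc m) = alt_prod G ?c (Suc m) [^] ?e"
      using c by (intro hom_alt_prod[OF sign_hom comm_group_axioms, symmetric]) auto
    finally show ?case
      using c alt_prod_closed[of "Suc m" ?c]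
      by (subst (asm) sign_Suc_cancel[of _ "Suc m"]) (auto simp del: power_Suc)
  qed
  then show ?thesis by simp
qed

end

section \<open>Normalization for cosimplicial abelian groups\<close>

definition coface :: "nat \<Rightarrow> nat \<Rightarrow> nat \<Rightarrow> nat" where
  "coface n i = (\<lambda>j\<in>{..n}. if j < i then j else Suc j)"

definition codegeneracy :: "nat \<Rightarrow> nat \<Rightarrow> nat \<Rightarrow> nat" where
  "codegeneracy n i = (\<lambda>j\<in>{..Suc n}. if j \<le> i then j else j - 1)"

lemma coface_ord_maps [simp]: "coface n i \<in> ord_maps n (Suc n)"
  by (auto simp: coface_def ord_maps_def PiE_iff mono_on_def)

lemma codegeneracy_ord_maps [simp]: "i \<le> n \<Longrightarrow> codegeneracy n i \<in> ord_maps (Suc n) n"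
  by (auto simp: codegeneracy_def ord_maps_def PiE_iff mono_on_def)

lemma coface_coface:
  "i < j \<Longrightarrow> compose {..n} (coface (Suc n) j) (coface n i)
    = compose {..n} (coface (Suc n) i) (coface n (j - 1))"
  by (auto simp: coface_def compose_def fun_eq_iff)

lemma codegeneracy_codegeneracy:
  "j < i \<Longrightarrow> i \<le> Suc n \<Longrightarrow>
    compose {..Suc (Suc n)} (codegeneracy n j) (codegeneracy (Suc n) i)
    = compose {..Suc (Suc n)} (codegeneracy n (i - 1)) (codegeneracy (Suc n) j)"
  by (auto simp: codegeneracy_def compose_def fun_eq_iff)

lemma codegeneracy_coface_id:
  "i = j \<or> i = Suc j \<Longrightarrow> j \<le> n \<Longrightarrow>
    compose {..n} (codegeneracy n j) (coface n i) = restrict id {..n}"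
  by (auto simp: codegeneracy_def coface_def compose_def fun_eq_iff)

lemma codegeneracy_coface_less:
  "i < j \<Longrightarrow> j \<le> Suc n \<Longrightarrow>
    compose {..Suc n} (codegeneracy (Suc n) j) (coface (Suc n) i)
    = compose {..Suc n} (coface n i) (codegeneracy n (j - 1))"
  by (auto simp: codegeneracy_def coface_def compose_def fun_eq_iff)

lemma codegeneracy_coface_greater:
  "Suc j < i \<Longrightarrow> i \<le> Suc (Suc n) \<Longrightarrow>
    compose {..Suc n} (codegeneracy (Suc n) j) (coface (Suc n) i)
    = compose {..Suc n} (coface n (i - 1)) (codegeneracy n j)"
  by (auto simp: codegeneracy_def coface_def compose_def fun_eq_iff)

text \<open>A covariant functor from the category of ordinals to abelian groups.\<close>

locale cosimplicial_group =
  fixes C :: "nat \<Rightarrow> 'c monoid" and P :: "nat \<Rightarrow> nat \<Rightarrow> (nat \<Rightarrow> nat) \<Rightarrow> 'c \<Rightarrow> 'c"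
  assumes comm: "comm_group (C n)"
    and P_hom: "\<theta> \<in> ord_maps m n \<Longrightarrow> P m n \<theta> \<in> hom (C m) (C n)"
    and P_id: "\<psi> \<in> carrier (C n) \<Longrightarrow> P n n (restrict id {..n}) \<psi> = \<psi>"
    and P_comp: "\<lbrakk>\<rho> \<in> ord_maps k m; \<theta> \<in> ord_maps m n; \<psi> \<in> carrier (C k)\<rbrakk>
      \<Longrightarrow> P k n (compose {..k} \<theta> \<rho>) \<psi> = P m n \<theta> (P k m \<rho> \<psi>)"
begin

definition d :: "nat \<Rightarrow> nat \<Rightarrow> 'c \<Rightarrow> 'c" where
  "d n i = P n (Suc n) (coface n i)"

definition s :: "nat \<Rightarrow> nat \<Rightarrow> 'c \<Rightarrow> 'c" where
  "s n i = P (Suc n) n (codegeneracy n i)"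

definition coboundary :: "nat \<Rightarrow> 'c \<Rightarrow> 'c" where
  "coboundary n \<psi> = alt_prod (C (Suc n)) (\<lambda>i. d n i \<psi>) (Suc n)"

text \<open>The common kernels of the first \<open>p\<close> codegeneracies lead from all cochains (\<open>p = 0\<close>) down to
  the normalized ones (\<open>p \<ge> n\<close>), and normalization goes through them one at a time.\<close>

definition vanishing :: "nat \<Rightarrow> nat \<Rightarrow> 'c set" where
  "vanishing p n = {\<psi> \<in> carrier (C n). \<forall>m i. n = Suc m \<longrightarrow> i \<le> m \<longrightarrow> i < p \<longrightarrow> s m i \<psi> = \<one>\<^bsub>C m\<^esub>}"

abbreviation normalized :: "nat \<Rightarrow> 'c set" where
  "normalized n \<equiv> vanishing n n"

lemma d_hom: "d n i \<in> hom (C n) (C (Suc n))"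
  unfolding d_def by (intro P_hom) simp

lemma s_hom: "i \<le> n \<Longrightarrow> s n i \<in> hom (C (Suc n)) (C n)"
  unfolding s_def by (intro P_hom) simp

lemma d_closed: "\<psi> \<in> carrier (C n) \<Longrightarrow> d n i \<psi> \<in> carrier (C (Suc n))"
  using d_hom by (auto simp: hom_def)

lemma s_closed: "\<psi> \<in> carrier (C (Suc n)) \<Longrightarrow> i \<le> n \<Longrightarrow> s n i \<psi> \<in> carrier (C n)"
  using s_hom by (auto simp: hom_def)

lemma group_C: "group (C n)"
  using comm by (rule comm_group.axioms)

lemma d_one: "d n i \<one>\<^bsub>C n\<^esub> = \<one>\<^bsub>C (Suc n)\<^esub>"
  using hom_one[OF d_hom group_C group_C] .

lemma s_one: "i \<le> n \<Longrightarrow> s n i \<one>\<^bsub>C (Suc n)\<^esub> = \<one>\<^bsub>C n\<^esub>"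
  using hom_one[OF s_hom group_C group_C] .

lemma d_d: "\<psi> \<in> carrier (C n) \<Longrightarrow> i < j \<Longrightarrow> d (Suc n) j (d n i \<psi>) = d (Suc n) i (d n (j - 1) \<psi>)"
  unfolding d_def by (simp add: coface_coface flip: P_comp)

lemma s_s:
  "\<psi> \<in> carrier (C (Suc (Suc n))) \<Longrightarrow> j < i \<Longrightarrow> i \<le> Suc n \<Longrightarrow>
    s n j (s (Suc n) i \<psi>) = s n (i - 1) (s (Suc n) j \<psi>)"
  unfolding s_def by (simp add: codegeneracy_codegeneracy flip: P_comp)

lemma s_d_id: "\<psi> \<in> carrier (C n) \<Longrightarrow> i = j \<or> i = Suc j \<Longrightarrow> j \<le> n \<Longrightarrow> s n j (d n i \<psi>) = \<psi>"
  unfolding s_def d_def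
  using codegeneracy_coface_id[of i j n] by (simp add: P_id flip: P_comp)

lemma s_d_less:
  "\<psi> \<in> carrier (C (Suc n)) \<Longrightarrow> i < j \<Longrightarrow> j \<le> Suc n \<Longrightarrow>
    s (Suc n) j (d (Suc n) i \<psi>) = d n i (s n (j - 1) \<psi>)"
  unfolding s_def d_def by (simp add: codegeneracy_coface_less flip: P_comp)

lemma s_d_greater:
  "\<psi> \<in> carrier (C (Suc n)) \<Longrightarrow> Suc j < i \<Longrightarrow> i \<le> Suc (Suc n) \<Longrightarrow>
    s (Suc n) j (d (Suc n) i \<psi>) = d n (i - 1) (s n j \<psi>)"
  unfolding s_def d_def by (simp add: codegeneracy_coface_greater flip: P_comp)

lemma coboundary_closed: "\<psi> \<in> carrier (C n) \<Longrightarrow> coboundary n \<psi> \<in> carrier (C (Suc n))"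
  unfolding coboundary_def by (rule comm_group.alt_prod_closed[OF comm d_closed])

lemma complex: "cochain_complex C coboundary"
proof (rule cochain_complex.intro)
  show "comm_group (C n)" for n by (rule comm)
  show "coboundary n \<in> hom (C n) (C (Suc n))" for n
  proof (rule homI)
    fix \<psi> \<chi> assume "\<psi> \<in> carrier (C n)" "\<chi> \<in> carrier (C n)"
    then show "coboundary n (\<psi> \<otimes>\<^bsub>C n\<^esub> \<chi>) = coboundary n \<psi> \<otimes>\<^bsub>C (Suc n)\<^esub> coboundary n \<chi>"
      unfolding coboundary_def
      by (simp add: hom_mult[OF d_hom] comm_group.alt_prod_mult[OF comm] d_closed)
  qed (rule coboundary_closed)
  fix n \<psi> assume \<psi>: "\<psi> \<in> carrier (C n)"
  have "coboundary (Suc n) (coboundary n \<psi>)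
      = alt_prod (C (Suc (Suc n)))
          (\<lambda>j. alt_prod (C (Suc (Suc n))) (\<lambda>i. d (Suc n) j (d n i \<psi>)) (Suc n)) (Suc (Suc n))"
    unfolding coboundary_def using \<psi>
    by (simp add: comm_group.hom_alt_prod[OF comm d_hom comm] d_closed)
  also have "\<dots> = \<one>\<^bsub>C (Suc (Suc n))\<^esub>"
    using \<psi> by (intro comm_group.alt_prod_alt_prod comm d_closed d_d)
  finally show "coboundary (Suc n) (coboundary n \<psi>) = \<one>\<^bsub>C (Suc (Suc n))\<^esub>" .
qed

lemma s_coboundary:
  assumes "\<psi> \<in> carrier (C n)" "j \<le> n"
  shows "s n j (coboundary n \<psi>) = alt_prod (C n) (\<lambda>i. s n j (d n i \<psi>)) (Suc n)"
  unfolding coboundary_def using assms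
  by (intro comm_group.hom_alt_prod[OF comm s_hom comm] d_closed)

text \<open>Among the terms \<open>s_j d_i \<psi>\<close>, those with \<open>i = j\<close> and \<open>i = j + 1\<close> are both \<open>\<psi>\<close> and cancel,
  and in the others a codegeneracy of index at most \<open>j\<close> moves past the coface onto \<open>\<psi>\<close>.\<close>

lemma s_coboundary_vanishing:
  assumes \<psi>: "\<psi> \<in> carrier (C n)" and j: "j \<le> n"
    and van: "\<And>m i. n = Suc m \<Longrightarrow> i \<le> m \<Longrightarrow> i \<le> j \<Longrightarrow> s m i \<psi> = \<one>\<^bsub>C m\<^esub>"
  shows "s n j (coboundary n \<psi>) = \<one>\<^bsub>C n\<^esub>"
  unfolding s_coboundary[OF \<psi> j]
proof (rule comm_group.alt_prod_pair[OF comm, where j = j])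
  show "s n j (d n i \<psi>) \<in> carrier (C n)" for i
    using \<psi> j by (intro s_closed d_closed)
  show "s n j (d n (Suc j) \<psi>) = s n j (d n j \<psi>)"
    using \<psi> j by (simp add: s_d_id)
  fix i assume i: "i \<le> Suc n" "i \<noteq> j" "i \<noteq> Suc j"
  then obtain m where n: "n = Suc m" using j by (cases n) auto
  consider "i < j" | "Suc j < i" using i by linarith
  then show "s n j (d n i \<psi>) = \<one>\<^bsub>C n\<^esub>"
  proof cases
    case 1
    then show ?thesis
      using s_d_less[of \<psi> m i j] \<psi> j van[OF n, of "j - 1"] by (simp add: n d_one)
  next
    case 2
    then show ?thesis
      using s_d_greater[of \<psi> m j i] \<psi> i van[OF n, of j] by (simp add: n d_one)
  qed
qed (use j in simp)

lemma coboundary_normalized: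
  assumes "\<psi> \<in> normalized n"
  shows "coboundary n \<psi> \<in> normalized (Suc n)"
  using assms s_coboundary_vanishing[of \<psi> n]
  by (auto simp: vanishing_def coboundary_closed)

lemma subgroup_vanishing: "subgroup (vanishing p n) (C n)"
proof -
  interpret group "C n" by (rule group_C)
  show ?thesis
  proof
    fix \<psi> \<chi> assume "\<psi> \<in> vanishing p n" "\<chi> \<in> vanishing p n"
    then show "\<psi> \<otimes>\<^bsub>C n\<^esub> \<chi> \<in> vanishing p n"
      using hom_mult[OF s_hom] group.is_monoid[OF group_C]
      by (auto simp: vanishing_def monoid.l_one[of "C _"])
  next
    fix \<psi> assume *: "\<psi> \<in> vanishing p n"
    have "s m i (inv\<^bsub>C n\<^esub> \<psi>) = \<one>\<^bsub>C m\<^esub>" if "n = Suc m" "i \<le> m" "i < p" for m i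
    proof -
      interpret h: group_hom "C (Suc m)" "C m" "s m i"
        using s_hom that by (simp add: group_hom_def group_hom_axioms_def group_C)
      show ?thesis using * that by (auto simp: vanishing_def)
    qed
    then show "inv\<^bsub>C n\<^esub> \<psi> \<in> vanishing p n" using * by (auto simp: vanishing_def)
  qed (auto simp: vanishing_def s_one)
qed

text \<open>Compare \<open>s_p s_p (\<delta> \<psi>)\<close>, which vanishes, with \<open>s_p (\<delta> (s_p \<psi>))\<close>.  By the cosimplicial
  identities the entries of the first alternating product arise from those of the second by
  inserting \<open>s_p \<psi>\<close> at position \<open>p\<close>, and the entries before that position are trivial in both.\<close>

lemma s_coboundary_s:
  assumes \<psi>: "\<psi> \<in> vanishing p (Suc m)" and p: "p \<le> m"
    and cob: "s (Suc m) p (coboundary (Suc m) \<psi>) = \<one>\<^bsub>C (Suc m)\<^esub>"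
  shows "s m p (coboundary m (s m p \<psi>)) = s m p \<psi> [^]\<^bsub>C m\<^esub> ((-1) ^ p :: int)"
proof -
  interpret C: comm_group "C m" by (rule comm)
  let ?f = "s m p \<psi>"
  let ?a = "\<lambda>i. s m p (s (Suc m) p (d (Suc m) i \<psi>))" and ?b = "\<lambda>i. s m p (d m i ?f)"
  have c: "\<psi> \<in> carrier (C (Suc m))" "?f \<in> carrier (C m)"
    and van: "\<And>i. i < p \<Longrightarrow> s m i \<psi> = \<one>\<^bsub>C m\<^esub>"
    using \<psi> p by (auto simp: vanishing_def intro: s_closed)
  have "alt_prod (C m) ?a (Suc (Suc m)) = s m p (s (Suc m) p (coboundary (Suc m) \<psi>))"
    unfolding s_coboundary[OF c(1) le_SucI[OF p]] using c p
    by (intro comm_group.hom_alt_prod[OF comm s_hom comm, symmetric] s_closed d_closed) auto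
  then have a: "alt_prod (C m) ?a (Suc (Suc m)) = \<one>\<^bsub>C m\<^esub>"
    using cob p by (simp add: s_one)
  have "alt_prod (C m) ?a (Suc (Suc m)) \<otimes>\<^bsub>C m\<^esub> alt_prod (C m) ?b (Suc m)
      = ?a p [^]\<^bsub>C m\<^esub> ((-1) ^ p :: int)"
  proof (rule C.alt_prod_shift)
    show "?a i \<in> carrier (C m)" for i using c p by (intro s_closed d_closed) auto
    show "?b i \<in> carrier (C m)" for i using c p by (intro s_closed d_closed) auto
    show "?a (Suc i) = ?b i" if "i \<le> Suc m" "p \<le> i" for i
      using that c p s_d_id[of \<psi> "Suc m" "Suc i" p] s_d_id[of ?f m i p]
        s_d_greater[of \<psi> m p "Suc i"] by (cases "i = p") auto
    show "?a i = \<one>\<^bsub>C m\<^esub>" if "i < p" for i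
      using that c p van[of "p - 1"] s_d_less[of \<psi> m i p] by (simp add: d_one s_one)
    show "?b i = \<one>\<^bsub>C m\<^esub>" if i: "i < p" for i
    proof -
      obtain k where k: "m = Suc k" using i p by (cases m) auto
      have "s k (p - 1) ?f = s k (p - 1) (s (Suc k) (p - 1) \<psi>)"
        using s_s[of \<psi> k "p - 1" p] c p i by (simp add: k)
      also have "\<dots> = \<one>\<^bsub>C k\<^esub>" using van[of "p - 1"] i p by (simp add: k s_one)
      finally show ?thesis
        using s_d_less[of ?f k i p] c p i by (simp add: k d_one)
    qed
    show "p \<le> Suc (Suc m)" using p by simp
  qed
  moreover have "?a p = ?f" using s_d_id[of \<psi> "Suc m" p p] c p by simp
  moreover have "alt_prod (C m) ?b (Suc m) \<in> carrier (C m)"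
    using c p by (intro C.alt_prod_closed s_closed d_closed)
  ultimately show ?thesis
    using a s_coboundary[of ?f m p] c p by simp
qed

text \<open>Multiplying with the coboundary of \<open>s_p \<psi>\<close>, up to sign, makes \<open>s_p\<close> vanish by the previous
  identity.  The lower codegeneracies stay trivial because \<open>s_j (s_p \<psi>)\<close> is trivial for \<open>j < p\<close>.\<close>

lemma vanishing_step:
  assumes \<psi>: "\<psi> \<in> vanishing p n" and cob: "coboundary n \<psi> \<in> normalized (Suc n)"
  shows "\<exists>b\<in>coboundaries C coboundary n. \<psi> \<otimes>\<^bsub>C n\<^esub> b \<in> vanishing (Suc p) n"
proof (cases "\<exists>m. n = Suc m \<and> p \<le> m")
  case False
  interpret group "C n" by (rule group_C)
  have "\<one>\<^bsub>C n\<^esub> \<in> coboundaries C coboundary n"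
    using cochain_complex.subgroup_coboundaries[OF complex] by (rule subgroup.one_closed)
  moreover have "\<psi> \<otimes>\<^bsub>C n\<^esub> \<one>\<^bsub>C n\<^esub> \<in> vanishing (Suc p) n"
    using \<psi> False by (auto simp: vanishing_def less_Suc_eq)
  ultimately show ?thesis by blast
next
  case True
  then obtain m where n: "n = Suc m" and p: "p \<le> m" by blast
  interpret C: comm_group "C m" by (rule comm)
  interpret D: comm_group "C (Suc m)" by (rule comm)
  interpret cob: group_hom "C m" "C (Suc m)" "coboundary m"
    by (rule cochain_complex.coboundary_group_hom[OF complex])
  let ?f = "s m p \<psi>" and ?e = "(-1) ^ p :: int"
  have c: "\<psi> \<in> carrier (C (Suc m))" "?f \<in> carrier (C m)"
    and van: "\<And>i. i < p \<Longrightarrow> s m i \<psi> = \<one>\<^bsub>C m\<^esub>"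
    using \<psi> p by (auto simp: n vanishing_def intro: s_closed)
  have sp: "s m p (coboundary m ?f) = ?f [^]\<^bsub>C m\<^esub> ?e"
    using \<psi> cob p by (intro s_coboundary_s) (auto simp: n vanishing_def)
  have sj: "s m j (coboundary m ?f) = \<one>\<^bsub>C m\<^esub>" if j: "j < p" for j
  proof (rule s_coboundary_vanishing)
    fix k i assume k: "m = Suc k" "i \<le> k" "i \<le> j"
    then show "s k i ?f = \<one>\<^bsub>C k\<^esub>"
      using s_s[of \<psi> k i p] c p j van[of i] by (simp add: s_one)
  qed (use c p j in auto)
  \<comment> \<open>The operator \<open>s_p \<delta>\<close> contributes the sign of \<open>p\<close> once more, and the two signs cancel.\<close>
  let ?x = "inv\<^bsub>C m\<^esub> (?f [^]\<^bsub>C m\<^esub> ?e)"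
  let ?b = "coboundary m ?x"
  have b: "?b = inv\<^bsub>C (Suc m)\<^esub> (coboundary m ?f [^]\<^bsub>C (Suc m)\<^esub> ?e)"
    using c by (simp add: cob.hom_int_pow)
  have "s m j (\<psi> \<otimes>\<^bsub>C (Suc m)\<^esub> ?b) = \<one>\<^bsub>C m\<^esub>" if j: "j \<le> p" for j
  proof -
    interpret h: group_hom "C (Suc m)" "C m" "s m j"
      using s_hom j p by (simp add: group_hom_def group_hom_axioms_def group_C)
    have "s m j (\<psi> \<otimes>\<^bsub>C (Suc m)\<^esub> ?b)
        = s m j \<psi> \<otimes>\<^bsub>C m\<^esub> inv\<^bsub>C m\<^esub> (s m j (coboundary m ?f) [^]\<^bsub>C m\<^esub> ?e)"
      unfolding b using c by (simp add: h.hom_int_pow)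
    also have "\<dots> = \<one>\<^bsub>C m\<^esub>"
    proof (cases "j = p")
      case True
      then show ?thesis
        using c by (simp add: sp C.int_pow_pow flip: power_mult_distrib)
    next
      case False
      then show ?thesis using j van sj by simp
    qed
    finally show ?thesis .
  qed
  then have "\<psi> \<otimes>\<^bsub>C (Suc m)\<^esub> ?b \<in> vanishing (Suc p) (Suc m)"
    using c by (auto simp: vanishing_def)
  moreover have "?b \<in> coboundaries C coboundary n"
    using c by (simp add: coboundaries_def n del: cob.hom_inv)
  ultimately show ?thesis unfolding n by blast
qed

text \<open>Multiplying with a coboundary leaves \<open>\<delta> \<psi>\<close> unchanged, so the step can be iterated.\<close>

lemma deform_into_vanishing:
  assumes "\<psi> \<in> carrier (C n)" "coboundary n \<psi> \<in> normalized (Suc n)"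
  shows "\<exists>b\<in>coboundaries C coboundary n. \<psi> \<otimes>\<^bsub>C n\<^esub> b \<in> vanishing p n"
proof (induction p)
  interpret B: subgroup "coboundaries C coboundary n" "C n"
    by (rule cochain_complex.subgroup_coboundaries[OF complex])
  interpret C: comm_group "C n" by (rule comm)
  interpret D: comm_group "C (Suc n)" by (rule comm)
  {
    case 0
    show ?case using assms B.one_closed by (intro bexI[of _ "\<one>\<^bsub>C n\<^esub>"]) (auto simp: vanishing_def)
  next
    case (Suc p)
    then obtain b where b: "b \<in> coboundaries C coboundary n" "\<psi> \<otimes>\<^bsub>C n\<^esub> b \<in> vanishing p n"
      by blast
    interpret cob: group_hom "C n" "C (Suc n)" "coboundary n"
      by (rule cochain_complex.coboundary_group_hom[OF complex])
    have "coboundary n b = \<one>\<^bsub>C (Suc n)\<^esub>"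
      using cochain_complex.coboundaries_subset[OF complex] b by (auto simp: kernel_def)
    then have "coboundary n (\<psi> \<otimes>\<^bsub>C n\<^esub> b) \<in> normalized (Suc n)"
      using assms b B.mem_carrier by simp
    from vanishing_step[OF b(2) this] obtain b'
      where "b' \<in> coboundaries C coboundary n" "(\<psi> \<otimes>\<^bsub>C n\<^esub> b) \<otimes>\<^bsub>C n\<^esub> b' \<in> vanishing (Suc p) n"
      by blast
    then show ?case
      using assms b B.m_closed B.mem_carrier by (auto simp: C.m_assoc)
  }
qed

theorem cohomology_normalized_iso:
  assumes "\<And>n \<psi>. \<psi> \<in> normalized n \<Longrightarrow> \<epsilon> n \<psi> = coboundary n \<psi>"
  shows "cohomology C coboundary n \<cong> cohomology (\<lambda>n. (C n)\<lparr>carrier := normalized n\<rparr>) \<epsilon> n"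
  using subgroup_vanishing coboundary_normalized assms deform_into_vanishing
  by (rule cochain_complex.cohomology_subcomplex_iso[OF complex])

end

section \<open>Cochains with coefficients in a simplicial action\<close>

locale simplicial_action = simplicial_set M + G: comm_group G
  for M :: "'a sset" and G :: "'g monoid" +
  fixes \<phi> :: "nat \<Rightarrow> 'a \<Rightarrow> ('g \<Rightarrow> 'g) list"
  assumes action: "partial_action M G \<phi>"
begin

sublocale Aut: group "AutoGroup G"
  by (rule G.AutoGroup)

text \<open>The action of the edge of \<open>x\<close> from vertex 0 to vertex \<open>k\<close>, read off from the spine of \<open>x\<close>.\<close>

definition transport :: "nat \<Rightarrow> nat \<Rightarrow> 'a \<Rightarrow> 'g \<Rightarrow> 'g" where
  "transport n k x = seg_prod (AutoGroup G) (\<phi> n x) 0 k"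

text \<open>A value at \<open>\<theta>\<^sup>*x\<close> is based at the vertex \<open>\<theta> 0\<close> of \<open>x\<close> and has to be carried back to
  vertex 0.  The twist of the coboundary on the face \<open>d_0\<close> is the case of the only coface
  that does not fix 0.\<close>

definition pull :: "nat \<Rightarrow> nat \<Rightarrow> (nat \<Rightarrow> nat) \<Rightarrow> ('a \<Rightarrow> 'g) \<Rightarrow> 'a \<Rightarrow> 'g" where
  "pull m n \<theta> \<psi> = (\<lambda>x\<in>simps M n. transport n (\<theta> 0) x (\<psi> (oper M m n \<theta> x)))"

lemma aut_hom: "f \<in> carrier (AutoGroup G) \<Longrightarrow> f \<in> hom G G"
  by (simp add: AutoGroup_def auto_def)

lemma aut_mult:
  "f \<in> carrier (AutoGroup G) \<Longrightarrow> g \<in> carrier (AutoGroup G) \<Longrightarrow> a \<in> carrier G \<Longrightarrow>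
    (f \<otimes>\<^bsub>AutoGroup G\<^esub> g) a = f (g a)"
  by (auto simp: AutoGroup_def auto_def BijGroup_def compose_def)

lemma aut_one: "a \<in> carrier G \<Longrightarrow> \<one>\<^bsub>AutoGroup G\<^esub> a = a"
  by (simp add: AutoGroup_def BijGroup_def)

lemma action_simplex:
  "x \<in> simps M n \<Longrightarrow> length (\<phi> n x) = n \<and> set (\<phi> n x) \<subseteq> carrier (AutoGroup G)"
  using action by (auto simp: partial_action_def simplicial_map_def bar_def)

lemma action_oper:
  "\<theta> \<in> ord_maps m n \<Longrightarrow> x \<in> simps M n \<Longrightarrow>
    \<phi> m (oper M m n \<theta> x)
      = map (\<lambda>i. seg_prod (AutoGroup G) (\<phi> n x) (\<theta> i) (\<theta> (Suc i))) [0..<m]"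
  using action by (auto simp: partial_action_def simplicial_map_def bar_def)

lemma transport_aut: "x \<in> simps M n \<Longrightarrow> k \<le> n \<Longrightarrow> transport n k x \<in> carrier (AutoGroup G)"
  unfolding transport_def using action_simplex by (intro Aut.seg_closed) auto

lemma transport_0: "a \<in> carrier G \<Longrightarrow> transport n 0 x a = a"
  by (simp add: transport_def aut_one)

lemma transport_1:
  assumes "x \<in> simps M (Suc n)"
  shows "transport (Suc n) 1 x = act \<phi> (edge M (Suc n) 1 x)"
proof -
  let ?\<theta> = "\<lambda>j\<in>{..1}. if j = 0 then 0 else 1 :: nat"
  have "?\<theta> \<in> ord_maps 1 (Suc n)"
    by (auto simp: ord_maps_def PiE_iff mono_on_def)
  moreover have "edge M (Suc n) 1 x = oper M 1 (Suc n) ?\<theta> x"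
    by (simp add: edge_def cong: if_cong)
  ultimately show ?thesis
    using action_oper[of ?\<theta> 1 "Suc n" x] assms by (simp add: act_def transport_def)
qed

text \<open>The edge of \<open>\<theta>\<^sup>*x\<close> from 0 to \<open>k\<close> is the edge of \<open>x\<close> from \<open>\<theta> 0\<close> to \<open>\<theta> k\<close>, and consecutive
  segments of a spine multiply.  This is what makes \<open>pull\<close> functorial.\<close>

lemma transport_comp:
  assumes "\<theta> \<in> ord_maps m n" "k \<le> m" "x \<in> simps M n"
  shows "transport n (\<theta> 0) x \<otimes>\<^bsub>AutoGroup G\<^esub> transport m k (oper M m n \<theta> x)
    = transport n (\<theta> k) x"
proof -
  have th: "\<theta> 0 \<le> \<theta> k" "\<theta> k \<le> n"
    using assms by (auto simp: ord_maps_def PiE_iff mono_on_def)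
  have "transport m k (oper M m n \<theta> x) = seg_prod (AutoGroup G) (\<phi> n x) (\<theta> 0) (\<theta> k)"
    unfolding transport_def using action_simplex[OF assms(3)] assms
    by (subst action_oper[OF assms(1,3)], intro Aut.seg_map[where n = n]) auto
  then show ?thesis
    unfolding transport_def using action_simplex[OF assms(3)] th by (simp add: Aut.seg_append)
qed

lemma cosimplicial_cochains: "cosimplicial_group (action_cochains M G) pull"
proof (rule cosimplicial_group.intro)
  show "comm_group (action_cochains M G n)" for n
  proof (rule group.group_comm_groupI)
    show "group (action_cochains M G n)"
      unfolding action_cochains_def by (intro product_group G.group_axioms)
  qed (auto simp: action_cochains_def PiE_iff G.m_comm)
next
  fix \<theta> m n assume th: "\<theta> \<in> ord_maps m n"
  have "transport n (\<theta> 0) x \<in> hom G G" if "x \<in> simps M n" for x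
    using th that by (intro aut_hom transport_aut) (auto simp: ord_maps_def PiE_iff)
  moreover from this have "transport n (\<theta> 0) x a \<in> carrier G"
    if "x \<in> simps M n" "a \<in> carrier G" for x a
    using that hom_in_carrier by metis
  ultimately show "pull m n \<theta> \<in> hom (action_cochains M G m) (action_cochains M G n)"
    using oper_closed[OF th]
    by (intro homI) (auto simp: action_cochains_def pull_def hom_mult PiE_iff)
next
  fix n \<psi> assume "\<psi> \<in> carrier (action_cochains M G n)"
  then show "pull n n (restrict id {..n}) \<psi> = \<psi>"
    by (auto simp: action_cochains_def pull_def PiE_iff extensional_def oper_id transport_0 fun_eq_iff)
next
  fix \<rho> k m \<theta> n \<psi>
  assume *: "\<rho> \<in> ord_maps k m" "\<theta> \<in> ord_maps m n" "\<psi> \<in> carrier (action_cochains M G k)"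
  have le: "\<rho> 0 \<le> m" "\<theta> 0 \<le> n" using * by (auto simp: ord_maps_def PiE_iff)
  show "pull k n (compose {..k} \<theta> \<rho>) \<psi> = pull m n \<theta> (pull k m \<rho> \<psi>)"
    unfolding pull_def
  proof (rule restrict_ext)
    fix x assume x: "x \<in> simps M n"
    let ?y = "oper M m n \<theta> x"
    have y: "?y \<in> simps M m" using x * by (intro oper_closed)
    have a: "\<psi> (oper M k m \<rho> ?y) \<in> carrier G"
      using * oper_closed[OF *(1) y] by (auto simp: action_cochains_def)
    have "transport n (\<theta> (\<rho> 0)) x (\<psi> (oper M k m \<rho> ?y))
        = transport n (\<theta> 0) x (transport m (\<rho> 0) ?y (\<psi> (oper M k m \<rho> ?y)))"
      using transport_comp[OF *(2) le(1) x] aut_mult[OF transport_aut[OF x le(2)] transport_aut[OF y le(1)] a]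
      by simp
    then show "transport n (compose {..k} \<theta> \<rho> 0) x (\<psi> (oper M k n (compose {..k} \<theta> \<rho>) x))
        = transport n (\<theta> 0) x ((\<lambda>x\<in>simps M m. transport m (\<rho> 0) x (\<psi> (oper M k m \<rho> x))) ?y)"
      using x y oper_comp[OF *(1,2) x] by (simp add: compose_def)
  qed
qed

sublocale cosimplicial_group "action_cochains M G" pull
  by (rule cosimplicial_cochains)

lemma evaluation_hom: "x \<in> simps M n \<Longrightarrow> (\<lambda>\<psi>. \<psi> x) \<in> hom (action_cochains M G n) G"
  by (auto simp: hom_def action_cochains_def)

lemma d_apply:
  assumes "\<psi> \<in> carrier (action_cochains M G n)" "x \<in> simps M (Suc n)" "i \<le> Suc n"
  shows "d n i \<psi> x = (if i = 0 then act \<phi> (edge M (Suc n) 1 x) (\<psi> (face M (Suc n) 0 x))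
    else \<psi> (face M (Suc n) i x))"
proof -
  have f: "oper M n (Suc n) (coface n i) x = face M (Suc n) i x"
    by (simp add: face_def coface_def)
  have "\<psi> (face M (Suc n) i x) \<in> carrier G"
    using assms face_closed[OF assms(2), of i] by (auto simp: action_cochains_def)
  moreover have "coface n i 0 = (if i = 0 then 1 else 0)" by (simp add: coface_def)
  ultimately show ?thesis
    using assms transport_1[OF assms(2)] by (simp add: d_def pull_def f transport_0)
qed

lemma s_apply:
  assumes "\<psi> \<in> carrier (action_cochains M G (Suc n))" "x \<in> simps M n" "i \<le> n"
  shows "s n i \<psi> x = \<psi> (degen M n i x)"
proof -
  have f: "oper M (Suc n) n (codegeneracy n i) x = degen M n i x"
    by (simp add: degen_def codegeneracy_def)
  have "\<psi> (degen M n i x) \<in> carrier G"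
    using assms degen_closed[OF assms(2,3)] by (auto simp: action_cochains_def)
  moreover have "codegeneracy n i 0 = 0" by (simp add: codegeneracy_def)
  ultimately show ?thesis
    using assms by (simp add: s_def pull_def f transport_0)
qed

lemma coboundary_eq_action_coboundary:
  assumes \<psi>: "\<psi> \<in> carrier (action_cochains M G n)"
  shows "coboundary n \<psi> = action_coboundary M G \<phi> n \<psi>"
proof (rule extensionalityI)
  show "coboundary n \<psi> \<in> extensional (simps M (Suc n))"
    using coboundary_closed[OF \<psi>] by (auto simp: action_cochains_def PiE_iff)
  show "action_coboundary M G \<phi> n \<psi> \<in> extensional (simps M (Suc n))"
    by (simp add: action_coboundary_def)
next
  fix x assume x: "x \<in> simps M (Suc n)"
  have c: "d n i \<psi> x \<in> carrier G" for i
    using d_closed[OF \<psi>] x by (auto simp: action_cochains_def)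
  have "coboundary n \<psi> x = alt_prod G (\<lambda>i. d n i \<psi> x) (Suc n)"
    unfolding coboundary_def
    using comm_group.hom_alt_prod[OF comm evaluation_hom[OF x] G.comm_group_axioms] d_closed[OF \<psi>]
    by simp
  also have "\<dots> = d n 0 \<psi> x \<otimes>\<^bsub>G\<^esub> (\<Otimes>\<^bsub>G\<^esub>i\<in>{1..Suc n}. d n i \<psi> x [^]\<^bsub>G\<^esub> ((-1) ^ i :: int))"
  proof -
    have "{..Suc n} = insert 0 {1..Suc n}" by auto
    then show ?thesis unfolding alt_prod_def using c by (simp add: G.finprod_insert)
  qed
  also have "(\<Otimes>\<^bsub>G\<^esub>i\<in>{1..Suc n}. d n i \<psi> x [^]\<^bsub>G\<^esub> ((-1) ^ i :: int))
      = (\<Otimes>\<^bsub>G\<^esub>i\<in>{1..Suc n}. \<psi> (face M (Suc n) i x) [^]\<^bsub>G\<^esub> ((-1) ^ i :: int))"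
    using c d_apply[OF \<psi> x] face_closed[OF x] \<psi>
    by (intro G.finprod_cong') (auto simp: action_cochains_def)
  also have "d n 0 \<psi> x = act \<phi> (edge M (Suc n) 1 x) (\<psi> (face M (Suc n) 0 x))"
    using d_apply[OF \<psi> x, of 0] by simp
  finally show "coboundary n \<psi> x = action_coboundary M G \<phi> n \<psi> x"
    using x by (simp add: action_coboundary_def)
qed

lemma normalized_eq:
  "normalized n = {\<psi> \<in> carrier (action_cochains M G n).
    \<forall>x\<in>simps M n. degenerate M n x \<longrightarrow> \<psi> x = \<one>\<^bsub>G\<^esub>}"
proof -
  have "s m i \<psi> = \<one>\<^bsub>action_cochains M G m\<^esub> \<longleftrightarrow> (\<forall>y\<in>simps M m. \<psi> (degen M m i y) = \<one>\<^bsub>G\<^esub>)"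
    if "\<psi> \<in> carrier (action_cochains M G (Suc m))" "i \<le> m" for m i \<psi>
  proof -
    have "s m i \<psi> = (\<lambda>y\<in>simps M m. \<psi> (degen M m i y))"
      using s_closed[OF that] s_apply[OF that(1) _ that(2)]
      by (intro extensionalityI) (auto simp: action_cochains_def PiE_iff)
    then show ?thesis
      by (auto simp: action_cochains_def fun_eq_iff restrict_def)
  qed
  then show ?thesis
    using degen_closed by (fastforce simp: vanishing_def degenerate_def)
qed

end

section \<open>Comparison with local coefficients\<close>

locale induced_action = simplicial_action M G \<phi>
  for M :: "'a sset" and G :: "'g monoid" and \<phi> +
  fixes A :: "('a, 'a pmor, 'g) ab_fun"
  assumes induced: "induced_coefficients M G \<phi> A"
begin

lemma base_group_eq:
  assumes "x \<in> simps M n"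
  shows "base_group M A n x = G"
proof -
  have "vert M n 0 x \<in> simps M 0"
    unfolding vert_def using assms
    by (intro oper_closed) (auto simp: ord_maps_def PiE_iff mono_on_def)
  then show ?thesis
    using induced by (simp add: base_group_def nerve_unit_def induced_coefficients_def)
qed

lemma local_cochains_eq: "local_cochains M A n = (action_cochains M G n)\<lparr>carrier := normalized n\<rparr>"
proof -
  have "product_group (simps M n) (base_group M A n) = action_cochains M G n"
    unfolding product_group_def action_cochains_def
    by (auto simp: base_group_eq fun_eq_iff restrict_def PiE_iff)
  then show ?thesis
    unfolding local_cochains_def normalized_eq Let_def by (auto simp: base_group_eq)
qed

text \<open>The system \<open>A\<close> is covariant while cochains pull values back along the first edge, so the
  coboundary of \<open>A\<close> inverts \<open>A(u_1) = \<phi>(x_1)\<^sup>-\<^sup>1\<close> and thereby recovers \<open>\<phi>(x_1)\<close>.\<close>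

lemma local_coboundary_eq:
  assumes \<psi>: "\<psi> \<in> carrier (action_cochains M G n)"
  shows "local_coboundary M A n \<psi> = action_coboundary M G \<phi> n \<psi>"
  unfolding local_coboundary_def action_coboundary_def Let_def
proof (rule restrict_ext)
  fix x assume x: "x \<in> simps M (Suc n)"
  let ?e = "edge M (Suc n) 1 x" and ?a = "\<psi> (face M (Suc n) 0 x)"
  have e: "?e \<in> simps M 1"
    unfolding edge_def using x
    by (intro oper_closed) (auto simp: ord_maps_def PiE_iff mono_on_def)
  have u: "hd (snd (nerve_unit M (Suc n) x)) = edge_class M ?e"
    by (simp add: nerve_unit_def spine_def upt_rec del: upt_Suc)
  have a: "?a \<in> carrier G"
    using \<psi> face_closed[OF x, of 0] by (auto simp: action_cochains_def)
  have act: "act \<phi> ?e \<in> carrier (AutoGroup G)"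
    using transport_aut[OF x, of 1] transport_1[OF x] by simp
  have inv: "fmor A (edge_class M ?e) b = (inv\<^bsub>AutoGroup G\<^esub> act \<phi> ?e) b" if "b \<in> carrier G" for b
    using induced e that by (simp add: induced_coefficients_def)
  have r: "act \<phi> ?e ((inv\<^bsub>AutoGroup G\<^esub> act \<phi> ?e) b) = b" if "b \<in> carrier G" for b
    using aut_mult[OF act Aut.inv_closed[OF act] that] act that by (simp add: aut_one)
  have l: "(inv\<^bsub>AutoGroup G\<^esub> act \<phi> ?e) (act \<phi> ?e b) = b" if "b \<in> carrier G" for b
    using aut_mult[OF Aut.inv_closed[OF act] act that] act that by (simp add: aut_one)
  have "inv_into (carrier G) (fmor A (edge_class M ?e)) ?a = act \<phi> ?e ?a"
  proof (rule inv_into_f_eq)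
    show "inj_on (fmor A (edge_class M ?e)) (carrier G)"
      by (rule inj_on_inverseI[where g = "act \<phi> ?e"]) (simp add: inv r del: One_nat_def)
    show m: "act \<phi> ?e ?a \<in> carrier G" using hom_in_carrier[OF aut_hom[OF act] a] .
    show "fmor A (edge_class M ?e) (act \<phi> ?e ?a) = ?a" using inv[OF m] l[OF a] by simp
  qed
  then show "inv_into (carrier (base_group M A (Suc n) x)) (fmor A (hd (snd (nerve_unit M (Suc n) x)))) ?a
        \<otimes>\<^bsub>base_group M A (Suc n) x\<^esub>
        (\<Otimes>\<^bsub>base_group M A (Suc n) x\<^esub>i\<in>{1..Suc n}.
          \<psi> (face M (Suc n) i x) [^]\<^bsub>base_group M A (Suc n) x\<^esub> ((-1) ^ i :: int))
      = act \<phi> ?e ?a \<otimes>\<^bsub>G\<^esub>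
        (\<Otimes>\<^bsub>G\<^esub>i\<in>{1..Suc n}. \<psi> (face M (Suc n) i x) [^]\<^bsub>G\<^esub> ((-1) ^ i :: int))"
    by (simp add: base_group_eq[OF x] u)
qed

lemma action_cohomology_iso_local: "action_cohomology M G \<phi> n \<cong> local_cohomology M A n"
proof -
  let ?C = "action_cochains M G" and ?\<delta> = "action_coboundary M G \<phi>"
  have "kernel (?C n) (?C (Suc n)) (?\<delta> n) = kernel (?C n) (?C (Suc n)) (coboundary n)"
    by (auto simp: kernel_def coboundary_eq_action_coboundary)
  moreover have "coboundaries ?C ?\<delta> n = coboundaries ?C coboundary n"
    by (auto simp: coboundaries_def coboundary_eq_action_coboundary)
  ultimately have "cohomology ?C ?\<delta> n = cohomology ?C coboundary n"
    by (simp add: cohomology_eq)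
  also have "\<dots> \<cong> cohomology (\<lambda>n. (action_cochains M G n)\<lparr>carrier := normalized n\<rparr>) (local_coboundary M A) n"
  proof (rule cohomology_normalized_iso)
    fix k \<psi> assume "\<psi> \<in> normalized k"
    then have "\<psi> \<in> carrier (action_cochains M G k)" by (simp add: vanishing_def)
    then show "local_coboundary M A k \<psi> = coboundary k \<psi>"
      by (simp add: coboundary_eq_action_coboundary local_coboundary_eq)
  qed
  also have "(\<lambda>n. (action_cochains M G n)\<lparr>carrier := normalized n\<rparr>) = local_cochains M A"
    by (simp add: local_cochains_eq fun_eq_iff)
  finally show ?thesis by (simp add: action_cohomology_def local_cohomology_def)
qed

end

theorem theorem2p6:
  fixes M :: "'a sset"
    and \<nu> :: "nat \<Rightarrow> 'a \<Rightarrow> 'a"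
    and G :: "'g monoid"
    and \<phi> :: "nat \<Rightarrow> 'a \<Rightarrow> ('g \<Rightarrow> 'g) list"
    and A :: "('a, 'a pmor, 'g) ab_fun"
  assumes "partial_group M \<nu>"
    and "comm_group G"
    and "partial_action M G \<phi>"
    and "induced_coefficients M G \<phi> A"
  shows "\<forall>n. action_cohomology M G \<phi> n \<cong> local_cohomology M A n"
proof -
  interpret partial_group M \<nu> by fact
  interpret induced_action M G \<phi> A
    using assms(2-4) simplicial_set_axioms
    by (simp add: induced_action_def induced_action_axioms_def
        simplicial_action_def simplicial_action_axioms_def)
  show ?thesis using action_cohomology_iso_local by blast
qed

end
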